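(* Let $(\mathcal{Q},\vartheta)$ be a minimal $\sigma$-periodic flow and let $\psi$ be a cocycle in a Banach space $\mathbb{E}$ (over $\mathbb{R}$ or $\mathbb{C}$) over $(\mathcal{Q},\vartheta)$. Suppose there are a constant symmetric operator $P\in\mathcal{L}(\mathbb{E};\mathbb{E}^* )$ and a constant direct sum decomposition $\mathbb{E}=\mathbb{E}^+\oplus\mathbb{E}^-$ (with bounded associated projectors) with $\dim\mathbb{E}^-=1$ such that $V(v):=\langle v,Pv\rangle$ is positive on $\mathbb{E}^+\setminus\{0\}$ and negative on $\mathbb{E}^-\setminus\{0\}$, and that $\psi$ satisfies the squeezing property with respect to $V$ with continuous $\nu_0(\cdot)$ and $\nu^->0$, asymptotic compactness with exponent $\gamma^+=\nu^+$, the uniform Lipschitz property and the continuous dependence property. Suppose there exists a sink $\mathcal{S}$ for the cocycle. Then there exists at least one $\sigma$-periodic trajectory which is Lyapunov stable.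
   Context: $\mathbb{R}_+=[0,\infty)$, $\sigma>0$. A minimal $\sigma$-periodic flow $(\mathcal{Q},\vartheta)$ is a (jointly continuous) flow on a complete metric space $\mathcal{Q}$ consisting of a single $\sigma$-periodic orbit: $\vartheta^\sigma=\mathrm{id}$ and $\mathcal{Q}=\{\vartheta^t(q):t\in[0,\sigma]\}$ for each $q$. $\mathbb{E}$ is continuously embedded in a Hilbert space $\mathbb{H}$ with norm $|\cdot|_{\mathbb{H}}$. A cocycle $\psi$ in $\mathbb{E}$ over $(\mathcal{Q},\vartheta)$ is a family of maps $\psi^t(q,\cdot)\colon\mathbb{E}\to\mathbb{E}$, $t\ge0$, $q\in\mathcal{Q}$, with $\psi^0(q,v)=v$, $\psi^{t+s}(q,v)=\psi^t(\vartheta^s(q),\psi^s(q,v))$ and $(t,q,v)\mapsto\psi^t(q,v)$ continuous. $\langle v,f\rangle$ is the pairing of $v\in\mathbb{E}$, $f\in\mathbb{E}^*$ (in the complex case $\mathbb{E}^*$ consists of conjugate-linear functionals); $P$ is symmetric if $\langle v_1,Pv_2\rangle=\overline{\langle v_2,Pv_1\rangle}$ for all $v_1,v_2\in\mathbb{E}$. A complete trajectory over $q$ is a continuous $v\colon\mathbb{R}\to\mathbb{E}$ with $v(t+s)=\psi^t(\vartheta^s(q),v(s))$ for $t\ge0$, $s\in\mathbb{R}$. Squeezing property: there are constants $\nu^-<\nu^+$, $\delta_P>0$, $\tau_P\ge0$ and a Borel function $\nu_0\colon\mathcal{Q}\to\mathbb{R}_+$ with $\nu^-\le\nu_0(\cdot)\le\nu^+$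 such that with $\nu(t;q)=\int_0^t\nu_0(\vartheta^s(q))ds$ $$e^{2\nu(r;q)}V(\psi^r(q,v_1)-\psi^r(q,v_2))-e^{2\nu(l;q)}V(\psi^l(q,v_1)-\psi^l(q,v_2))\le-\delta_P\int_l^re^{2\nu(s;q)}|\psi^s(q,v_1)-\psi^s(q,v_2)|^2_{\mathbb{H}}ds$$ for all $q\in\mathcal{Q}$, $v_1,v_2\in\mathbb{E}$ and $r,l\ge0$ with $r-l\ge\tau_P$. Uniform Lipschitz property: there is $\tau_S\ge0$ such that for every $T>0$ there is $L_T>0$ with $\|\psi^t(q,v_1)-\psi^t(q,v_2)\|_{\mathbb{E}}\le L_T|v_1-v_2|_{\mathbb{H}}$ for $t\in[\tau_S,\tau_S+T]$ and $\|\psi^t(q,v_1)-\psi^t(q,v_2)\|_{\mathbb{E}}\le L_T\|v_1-v_2\|_{\mathbb{E}}$ for $t\in[0,T]$, for all $q,v_1,v_2$. Asymptotic compactness with exponent $\gamma^+$: for every compact $\mathcal{C}\subset\mathcal{Q}$ there is $\gamma_0\colon\mathbb{R}_+\to\mathbb{R}_+$ with $\gamma_0(t)\to0$ as $t\to+\infty$ and $\alpha_K(\psi^t(\mathcal{C},\mathcal{B}))\le\gamma_0(t)e^{-\gamma^+t}\alpha_K(\mathcal{B})$ for all $t\ge0$ and bounded $\mathcal{B}\subset\mathbb{E}$, where $\alpha_K$ is the Kuratowski measure of noncompactness in $\mathbb{E}$. Continuous dependence property: the operators $P(q)$ defining the quadratic forms and the projectors onto $\mathbb{E}^-(q)$ along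 $\mathbb{E}^+(q)$ depend continuously on $q\in\mathcal{Q}$ in operator norm; here $P(q)\equiv P$, $\mathbb{E}^\pm(q)\equiv\mathbb{E}^\pm$ are constant, so it holds automatically. Sink: a nonempty closed bounded set $\mathcal{S}\subset\mathbb{E}$ for which there is an open set $\mathcal{U}\subset\mathbb{E}$ with $\mathcal{S}\subset\mathcal{U}$ such that for every $v_0\in\mathcal{U}$ and $q\in\mathcal{Q}$ there is $t_0=t_0(q,v_0)$ with $\psi^t(q,v_0)\in\mathcal{S}$ for all $t\ge t_0$. Lyapunov stability: a $\sigma$-periodic complete trajectory $w(\cdot)$ over $q$ is Lyapunov stable if for every $\varepsilon>0$ and $s\in\mathbb{R}$ there is $\delta>0$ such that $\|v_0-w(s)\|_{\mathbb{E}}<\delta$ implies $\|\psi^t(\vartheta^s(q),v_0)-w(t+s)\|_{\mathbb{E}}<\varepsilon$ for all $t\ge0$.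
   Formalization: The condition dim E^- = 1 is read as real dimension, so the theorem covers Banach spaces over R only; over C with complex dimension one the claim fails (planar flow r'=r(1-r^2), θ'=1, V=-|v|^2, σ=1). *)

theory Defs
  imports "HOL-Analysis.Analysis"
begin

section \<open>Scalars\<close>

text \<open>
  The scalar field is real or complex: \<open>to_complex\<close> carries a type of this class
  isometrically and isomorphically onto a real subalgebra of the complex numbers, i.e. onto
  the reals or onto all complex numbers; on the reals \<open>conjugate\<close> is the identity.
\<close>

class real_or_complex = real_normed_field +
  fixes to_complex :: "'a \<Rightarrow> complex"
    and conjugate :: "'a \<Rightarrow> 'a"
  assumes to_complex_add: "to_complex (x + y) = to_complex x + to_complex y"
    and to_complex_mult: "to_complex (x * y) = to_complex x * to_complex y"
    and to_complex_one: "to_complex 1 = 1"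
    and to_complex_scaleR: "to_complex (r *\<^sub>R x) = r *\<^sub>R to_complex x"
    and norm_to_complex: "cmod (to_complex x) = norm x"
    and to_complex_conjugate: "to_complex (conjugate x) = cnj (to_complex x)"

instantiation real :: real_or_complex
begin

definition to_complex_real :: "real \<Rightarrow> complex" where
  "to_complex_real x = complex_of_real x"

definition conjugate_real :: "real \<Rightarrow> real" where
  "conjugate_real x = x"

instance
  by standard (simp_all add: to_complex_real_def conjugate_real_def scaleR_conv_of_real)

end

instantiation complex :: real_or_complex
begin

definition to_complex_complex :: "complex \<Rightarrow> complex" where
  "to_complex_complex x = x"

definition conjugate_complex :: "complex \<Rightarrow> complex" where
  "conjugate_complex x = cnj x"

instance
  by standard (simp_all add: to_complex_complex_def conjugate_complex_def)

end

text \<open>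
  A normed space over \<open>'k\<close> is a real normed space with a compatible scalar multiplication.
  If the underlying real norm comes from a real inner product, then homogeneity of the norm
  under complex scalars makes it (by polarization) the norm of a complex inner product.
\<close>

definition normed_space_over ::
    "('k::real_or_complex \<Rightarrow> 'a::real_normed_vector \<Rightarrow> 'a) \<Rightarrow> bool" where
  "normed_space_over smul \<longleftrightarrow>
     vector_space smul \<and>
     (\<forall>r v. smul (of_real r) v = r *\<^sub>R v) \<and>
     (\<forall>c v. norm (smul c v) = norm c * norm v)"

definition continuous_embedding ::
    "('k::real_or_complex \<Rightarrow> 'a::real_normed_vector \<Rightarrow> 'a) \<Rightarrow>
     ('k \<Rightarrow> 'h::real_normed_vector \<Rightarrow> 'h) \<Rightarrow> ('a \<Rightarrow>\<^sub>L 'h) \<Rightarrow> bool" where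
  "continuous_embedding smulE smulH J \<longleftrightarrow>
     inj (blinfun_apply J) \<and> (\<forall>c v. J (smulE c v) = smulH c (J v))"


section \<open>Operators into the dual and splittings\<close>

text \<open>
  The dual consists of the bounded conjugate-linear functionals, with pairing
  \<open>\<langle>v, f\<rangle> = f v\<close>. An operator into the dual is a real-bounded-linear map
  with values in the conjugate-linear functionals that respects the scalars, so the operator
  norms are the usual ones.
\<close>

definition dual_space ::
    "('k::real_or_complex \<Rightarrow> 'a::real_normed_vector \<Rightarrow> 'a) \<Rightarrow> ('a \<Rightarrow>\<^sub>L 'k) set" where
  "dual_space smul = {f. \<forall>c v. blinfun_apply f (smul c v) = conjugate c * blinfun_apply f v}"

definition operator_into_dual ::
    "('k::real_or_complex \<Rightarrow> 'a::real_normed_vector \<Rightarrow> 'a) \<Rightarrow> ('a \<Rightarrow>\<^sub>L ('a \<Rightarrow>\<^sub>L 'k)) \<Rightarrow> bool" where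
  "operator_into_dual smul P \<longleftrightarrow>
     (\<forall>v. P v \<in> dual_space smul) \<and> (\<forall>c v w. P (smul c v) w = c * P v w)"

definition pairing :: "'a::real_normed_vector \<Rightarrow> ('a \<Rightarrow>\<^sub>L 'k::real_or_complex) \<Rightarrow> 'k" where
  "pairing v f = f v"

definition symmetric_operator ::
    "('a::real_normed_vector \<Rightarrow>\<^sub>L ('a \<Rightarrow>\<^sub>L 'k::real_or_complex)) \<Rightarrow> bool" where
  "symmetric_operator P \<longleftrightarrow> (\<forall>v1 v2. pairing v1 (P v2) = conjugate (pairing v2 (P v1)))"

text \<open>For symmetric \<open>P\<close> the value \<open>\<langle>v, P v\<rangle>\<close> is real; \<open>Re\<close> only changes the type.\<close>

definition quadratic_form ::
    "('a::real_normed_vector \<Rightarrow>\<^sub>L ('a \<Rightarrow>\<^sub>L 'k::real_or_complex)) \<Rightarrow> 'a \<Rightarrow> real" where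
  "quadratic_form P v = Re (to_complex (pairing v (P v)))"

text \<open>
  \<open>Pm\<close> is the bounded projector onto \<open>Em\<close> along \<open>Ep\<close>; the complementary projector
  \<open>id - Pm\<close> is then bounded as well.

  Both subspaces are closed under the scalars of \<open>'k\<close>, but dimension is always real
  dimension (the library's \<open>dim\<close>). Since a complex subspace has even real dimension, a splitting
  with \<open>dim Em = 1\<close> exists over real scalars only. This cannot be relaxed to complex
  dimension one: over the complex field with \<open>Em\<close> of complex dimension one, stable
  periodic trajectories need not exist: take the plane with \<open>V v = - |v|^2\<close>, \<open>Ep = {0}\<close>, period
  \<open>1\<close>, and the flow given in polar coordinates by \<open>r' = r (1 - r^2)\<close> (made globally Lipschitz
  for large \<open>r\<close>) and angular velocity \<open>1\<close>.
\<close>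

definition direct_sum_splitting ::
    "('k::real_or_complex \<Rightarrow> 'a::real_normed_vector \<Rightarrow> 'a) \<Rightarrow> 'a set \<Rightarrow> 'a set \<Rightarrow> ('a \<Rightarrow>\<^sub>L 'a) \<Rightarrow> bool" where
  "direct_sum_splitting smul Ep Em Pm \<longleftrightarrow>
     module.subspace smul Ep \<and> module.subspace smul Em \<and>
     Ep \<inter> Em = {0} \<and> (\<forall>v. \<exists>x\<in>Ep. \<exists>y\<in>Em. v = x + y) \<and>
     (\<forall>x\<in>Ep. \<forall>y\<in>Em. Pm (x + y) = y)"


section \<open>Flows and cocycles\<close>

definition minimal_periodic_flow :: "real \<Rightarrow> (real \<Rightarrow> 'q::metric_space \<Rightarrow> 'q) \<Rightarrow> bool" where
  "minimal_periodic_flow \<sigma> \<theta> \<longleftrightarrow>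
     (\<forall>q. \<theta> 0 q = q) \<and> (\<forall>t s q. \<theta> (t + s) q = \<theta> t (\<theta> s q)) \<and>
     continuous_on UNIV (\<lambda>(t, q). \<theta> t q) \<and>
     (\<forall>q. \<theta> \<sigma> q = q) \<and> (\<forall>q. UNIV = (\<lambda>t. \<theta> t q) ` {0..\<sigma>})"

text \<open>In the notions below \<open>\<psi> t\<close> is meaningful for \<open>t \<ge> 0\<close> only.\<close>

definition cocycle ::
    "(real \<Rightarrow> 'q::metric_space \<Rightarrow> 'q) \<Rightarrow> (real \<Rightarrow> 'q \<Rightarrow> 'a::real_normed_vector \<Rightarrow> 'a) \<Rightarrow> bool" where
  "cocycle \<theta> \<psi> \<longleftrightarrow>
     (\<forall>q v. \<psi> 0 q v = v) \<and>
     (\<forall>t\<ge>0. \<forall>s\<ge>0. \<forall>q v. \<psi> (t + s) q v = \<psi> t (\<theta> s q) (\<psi> s q v)) \<and>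
     continuous_on ({0..} \<times> UNIV \<times> UNIV) (\<lambda>(t, q, v). \<psi> t q v)"

definition complete_trajectory ::
    "(real \<Rightarrow> 'q \<Rightarrow> 'q) \<Rightarrow> (real \<Rightarrow> 'q \<Rightarrow> 'a::real_normed_vector \<Rightarrow> 'a) \<Rightarrow>
     'q \<Rightarrow> (real \<Rightarrow> 'a) \<Rightarrow> bool" where
  "complete_trajectory \<theta> \<psi> q w \<longleftrightarrow>
     continuous_on UNIV w \<and> (\<forall>s. \<forall>t\<ge>0. w (t + s) = \<psi> t (\<theta> s q) (w s))"

definition periodic_with :: "real \<Rightarrow> (real \<Rightarrow> 'a) \<Rightarrow> bool" where
  "periodic_with \<sigma> w \<longleftrightarrow> (\<forall>t. w (t + \<sigma>) = w t)"

definition lyapunov_stable ::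
    "(real \<Rightarrow> 'q \<Rightarrow> 'q) \<Rightarrow> (real \<Rightarrow> 'q \<Rightarrow> 'a::real_normed_vector \<Rightarrow> 'a) \<Rightarrow>
     'q \<Rightarrow> (real \<Rightarrow> 'a) \<Rightarrow> bool" where
  "lyapunov_stable \<theta> \<psi> q w \<longleftrightarrow>
     (\<forall>\<epsilon>>0. \<forall>s. \<exists>\<delta>>0. \<forall>v0. norm (v0 - w s) < \<delta> \<longrightarrow>
        (\<forall>t\<ge>0. norm (\<psi> t (\<theta> s q) v0 - w (t + s)) < \<epsilon>))"

definition sink :: "(real \<Rightarrow> 'q \<Rightarrow> 'a::real_normed_vector \<Rightarrow> 'a) \<Rightarrow> 'a set \<Rightarrow> bool" where
  "sink \<psi> S \<longleftrightarrow>
     S \<noteq> {} \<and> closed S \<and> bounded S \<and>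
     (\<exists>U. open U \<and> S \<subseteq> U \<and>
        (\<forall>v0\<in>U. \<forall>q. \<exists>t0\<ge>0. \<forall>t\<ge>t0. \<psi> t q v0 \<in> S))"


section \<open>Hypotheses on the cocycle\<close>

definition exponent_integral ::
    "(real \<Rightarrow> 'q \<Rightarrow> 'q) \<Rightarrow> ('q \<Rightarrow> real) \<Rightarrow> real \<Rightarrow> 'q \<Rightarrow> real" where
  "exponent_integral \<theta> \<nu>0 t q = integral {0..t} (\<lambda>s. \<nu>0 (\<theta> s q))"

definition squeezing_property ::
    "(real \<Rightarrow> 'q::metric_space \<Rightarrow> 'q) \<Rightarrow> (real \<Rightarrow> 'q \<Rightarrow> 'a \<Rightarrow> 'a) \<Rightarrow>
     ('a::real_normed_vector \<Rightarrow>\<^sub>L 'h::real_normed_vector) \<Rightarrow> ('a \<Rightarrow> real) \<Rightarrow>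
     real \<Rightarrow> real \<Rightarrow> ('q \<Rightarrow> real) \<Rightarrow> bool" where
  "squeezing_property \<theta> \<psi> J V \<nu>m \<nu>p \<nu>0 \<longleftrightarrow>
     \<nu>m < \<nu>p \<and> \<nu>0 \<in> borel_measurable borel \<and>
     (\<forall>q. 0 \<le> \<nu>0 q \<and> \<nu>m \<le> \<nu>0 q \<and> \<nu>0 q \<le> \<nu>p) \<and>
     (\<exists>\<delta>>0. \<exists>\<tau>\<ge>0. \<forall>q v1 v2. \<forall>r\<ge>0. \<forall>l\<ge>0. r - l \<ge> \<tau> \<longrightarrow>
        exp (2 * exponent_integral \<theta> \<nu>0 r q) * V (\<psi> r q v1 - \<psi> r q v2)
        - exp (2 * exponent_integral \<theta> \<nu>0 l q) * V (\<psi> l q v1 - \<psi> l q v2)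
        \<le> - \<delta> * integral {l..r}
              (\<lambda>s. exp (2 * exponent_integral \<theta> \<nu>0 s q) * (norm (J (\<psi> s q v1 - \<psi> s q v2)))\<^sup>2))"

definition uniform_lipschitz_property ::
    "(real \<Rightarrow> 'q \<Rightarrow> 'a \<Rightarrow> 'a) \<Rightarrow> ('a::real_normed_vector \<Rightarrow>\<^sub>L 'h::real_normed_vector) \<Rightarrow> bool" where
  "uniform_lipschitz_property \<psi> J \<longleftrightarrow>
     (\<exists>\<tau>\<ge>0. \<forall>T>0. \<exists>L>0. \<forall>q v1 v2.
        (\<forall>t\<in>{\<tau>..\<tau> + T}. norm (\<psi> t q v1 - \<psi> t q v2) \<le> L * norm (J (v1 - v2))) \<and>
        (\<forall>t\<in>{0..T}. norm (\<psi> t q v1 - \<psi> t q v2) \<le> L * norm (v1 - v2)))"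

text \<open>
  The Kuratowski measure of noncompactness takes the value infinity on unbounded sets.
  Boundedness of the covering sets is explicit since \<open>diameter\<close> is only meaningful for them.
\<close>

definition kuratowski_measure :: "'a::metric_space set \<Rightarrow> ennreal" where
  "kuratowski_measure B =
     Inf {ennreal d | d. d \<ge> 0 \<and>
       (\<exists>F. finite F \<and> B \<subseteq> \<Union>F \<and> (\<forall>A\<in>F. bounded A \<and> diameter A \<le> d))}"

definition asymptotically_compact ::
    "real \<Rightarrow> (real \<Rightarrow> 'q::metric_space \<Rightarrow> 'a::real_normed_vector \<Rightarrow> 'a) \<Rightarrow> bool" where
  "asymptotically_compact \<gamma> \<psi> \<longleftrightarrow>
     (\<forall>C. compact C \<longrightarrow>
       (\<exists>\<gamma>0 :: real \<Rightarrow> real. (\<forall>t\<ge>0. 0 \<le> \<gamma>0 t) \<and> (\<gamma>0 \<longlongrightarrow> 0) at_top \<and>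
         (\<forall>t\<ge>0. \<forall>B. bounded B \<longrightarrow>
            kuratowski_measure {\<psi> t q v | q v. q \<in> C \<and> v \<in> B}
              \<le> ennreal (\<gamma>0 t * exp (- \<gamma> * t)) * kuratowski_measure B)))"

definition continuous_dependence_property ::
    "('q::topological_space \<Rightarrow> ('a::real_normed_vector \<Rightarrow>\<^sub>L ('a \<Rightarrow>\<^sub>L 'k::real_or_complex))) \<Rightarrow>
     ('q \<Rightarrow> ('a \<Rightarrow>\<^sub>L 'a)) \<Rightarrow> bool" where
  "continuous_dependence_property P Pm \<longleftrightarrow> continuous_on UNIV P \<and> continuous_on UNIV Pm"

end

theory Submission
  imports Defs
begin

text \<open>
  Let \<open>T\<close> be the time-\<open>\<sigma>\<close> map over a base point. Its fixed points are the initial values of the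
  \<open>\<sigma>\<close>-periodic trajectories, and by the Lipschitz bound on one period a fixed point that is stable
  for the iterates of \<open>T\<close> gives a Lyapunov stable trajectory. So a stable fixed point of \<open>T\<close> is wanted.

  The negative subspace is a line; let \<open>h\<close> be the coordinate of the projection onto it, so that
  \<open>h v = 0\<close> forces \<open>V v \<ge> 0\<close>. Call a point ancient if it has a bounded backward \<open>T\<close>-orbit. Applying
  the squeezing inequality from a time far in the past, where the exponential weight (\<open>\<nu>m > 0\<close>) makes
  the initial value of \<open>V\<close> negligible, shows that \<open>V\<close> is negative on the difference of two distinct ancient
  points at every later time (\<open>ancient_separation\<close>). Hence \<open>h\<close> is injective on ancient points, and
  by continuity in time the flow preserves their order by \<open>h\<close>: on ancient points \<open>T\<close> acts like an
  increasing map of a subset of the line.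

  The rest mimics the one-dimensional argument. Asymptotic compactness makes limits
  of long bounded orbit segments ancient (\<open>limit_backward_orbit\<close>), so bounded monotone orbits converge to
  fixed points, and the set \<open>F\<close> of fixed points in the sink is nonempty and compact. If a fixed point is
  unstable, escaping orbits have in the limit a backward orbit that emanates from it either upwards or
  downwards (\<open>unstable_repels\<close>). If \<open>p \<in> F\<close> repels upwards, the emanating orbit must be attracted to the
  next element of \<open>F\<close> above, and this successor cannot repel downwards since two orbits between the
  same neighbours would have to cross (\<open>repels_above_successor\<close>). Therefore the lowest
  point of \<open>F\<close> that does not repel upwards does not repel downwards either: its predecessor would
  be a still lower such point. This point is stable.

  Ancient points alone do not suffice for the order argument, because the escaping orbits start at arbitrary
  points near \<open>p\<close>. For these, \<open>barrier_persists\<close> shows that a fixed point above \<open>p\<close> cannot be overtaken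
  by orbits starting close to \<open>p\<close>.
\<close>

section \<open>Ancient points of a map\<close>

definition backward_orbit :: "('a::metric_space \<Rightarrow> 'a) \<Rightarrow> (nat \<Rightarrow> 'a) \<Rightarrow> bool" where
  "backward_orbit T z \<longleftrightarrow> (\<forall>j. T (z (Suc j)) = z j) \<and> bounded (range z)"

definition ancient :: "('a::metric_space \<Rightarrow> 'a) \<Rightarrow> 'a set" where
  "ancient T = {z 0 | z. backward_orbit T z}"

lemma backward_orbit_shift: "backward_orbit T z \<Longrightarrow> backward_orbit T (\<lambda>j. z (j + n))"
  unfolding backward_orbit_def by (auto intro: bounded_subset)

lemma backward_orbit_ancient: "backward_orbit T z \<Longrightarrow> z n \<in> ancient T"
  unfolding ancient_def using backward_orbit_shift[of T z n] by (auto intro!: exI[of _ "\<lambda>j. z (j + n)"])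

lemma backward_orbit_funpow:
  assumes "backward_orbit T z"
  shows "(T ^^ n) (z (n + j)) = z j"
proof (induction n)
  case (Suc n)
  have "(T ^^ Suc n) (z (Suc n + j)) = (T ^^ n) (T (z (Suc (n + j))))"
    by (simp add: funpow_swap1)
  then show ?case using Suc assms by (simp add: backward_orbit_def)
qed simp

lemma fixed_ancient:
  assumes "T p = p"
  shows "p \<in> ancient T"
  unfolding ancient_def backward_orbit_def using assms by (auto intro!: exI[of _ "\<lambda>_. p"])

lemma ancient_image:
  assumes "x \<in> ancient T"
  shows "T x \<in> ancient T"
proof -
  obtain z where z: "backward_orbit T z" "z 0 = x" using assms by (auto simp: ancient_def)
  have "range (case_nat (T x) z) \<subseteq> insert (T x) (range z)" by (auto split: nat.splits)
  moreover have "bounded (insert (T x) (range z))" using z by (simp add: backward_orbit_def)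
  ultimately have "bounded (range (case_nat (T x) z))" using bounded_subset by blast
  then have "backward_orbit T (case_nat (T x) z)"
    using z by (auto simp: backward_orbit_def split: nat.splits)
  from backward_orbit_ancient[OF this, of 0] show ?thesis by simp
qed

lemma ancient_funpow: "x \<in> ancient T \<Longrightarrow> (T ^^ n) x \<in> ancient T"
  by (induction n) (auto intro: ancient_image)

lemma fixed_funpow: "T p = p \<Longrightarrow> (T ^^ n) p = p"
  by (induction n) auto

lemma continuous_funpow:
  fixes T :: "'a::topological_space \<Rightarrow> 'a"
  assumes "continuous_on UNIV T"
  shows "continuous_on UNIV (T ^^ n)"
proof (induction n)
  case (Suc n)
  then show ?case using assms
    by (auto intro: continuous_on_compose2[of UNIV T UNIV "T ^^ n"] simp: o_def)
qed (simp add: id_def)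

section \<open>Maps that are monotone on their ancient points\<close>

text \<open>
  The abstract form of the time-\<open>\<sigma>\<close> map: a map that is strictly increasing along a height function
  \<open>h\<close>, but only on its ancient points. The two barrier assumptions are the part of monotonicity that
  survives for arbitrary initial values near a fixed point.
\<close>

locale monotone_on_ancient =
  fixes T :: "'a::metric_space \<Rightarrow> 'a" and h :: "'a \<Rightarrow> real" and S U :: "'a set"
  assumes continuous_T: "continuous_on UNIV T"
    and continuous_h: "continuous_on UNIV h"
    and bounded_h: "bounded B \<Longrightarrow> bounded (h ` B)"
    and inj_h: "inj_on h (ancient T)"
    and strict_mono_T: "x \<in> ancient T \<Longrightarrow> y \<in> ancient T \<Longrightarrow> h x < h y \<Longrightarrow> h (T x) < h (T y)"
    and asymp_compact: "bounded B \<Longrightarrow> filterlim n at_top sequentially \<Longrightarrow>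
      \<forall>k. \<forall>j\<le>n k. (T ^^ j) (u k) \<in> B \<Longrightarrow>
      \<exists>r l. strict_mono (r :: nat \<Rightarrow> nat) \<and> (\<lambda>k. (T ^^ n (r k)) (u (r k))) \<longlonglongrightarrow> l"
    and barrier_above: "T p = p \<Longrightarrow> T f = f \<Longrightarrow> h p < h f \<Longrightarrow>
      \<exists>\<delta>>0. \<forall>u. dist u p < \<delta> \<longrightarrow> (\<forall>n. h ((T ^^ n) u) < h f)"
    and barrier_below: "T p = p \<Longrightarrow> T f = f \<Longrightarrow> h f < h p \<Longrightarrow>
      \<exists>\<delta>>0. \<forall>u. dist u p < \<delta> \<longrightarrow> (\<forall>n. h f < h ((T ^^ n) u))"
    and sink_nonempty: "S \<noteq> {}" and sink_closed: "closed S" and sink_bounded: "bounded S"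
    and basin_open: "open U" and sink_basin: "S \<subseteq> U"
    and attracted: "v \<in> U \<Longrightarrow> \<exists>n0. \<forall>n\<ge>n0. (T ^^ n) v \<in> S"
begin

lemma tendsto_T: "x \<longlonglongrightarrow> l \<Longrightarrow> (\<lambda>k. T (x k)) \<longlonglongrightarrow> T l"
  using continuous_on_tendsto_compose[OF continuous_T] by force

lemma tendsto_h: "x \<longlonglongrightarrow> l \<Longrightarrow> (\<lambda>k. h (x k)) \<longlonglongrightarrow> h l"
  using continuous_on_tendsto_compose[OF continuous_h] by force

text \<open>
  Turning the order upside down gives every statement about upwards repulsion a downwards twin.
\<close>

lemma reversed: "monotone_on_ancient T (\<lambda>x. - h x) S U"
proof
  show "continuous_on UNIV (\<lambda>x. - h x)" using continuous_h by (intro continuous_intros)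
  show "bounded ((\<lambda>x. - h x) ` B)" if "bounded B" for B
  proof -
    have "(\<lambda>x. - h x) ` B = uminus ` (h ` B)" by (simp add: image_image)
    then show ?thesis using bounded_h[OF that] by (simp only: bounded_uminus)
  qed
  show "inj_on (\<lambda>x. - h x) (ancient T)" using inj_h by (simp add: inj_on_def)
  show "\<exists>n0. \<forall>n\<ge>n0. (T ^^ n) v \<in> S" if "v \<in> U" for v using attracted[OF that] .
qed (use continuous_T strict_mono_T asymp_compact barrier_above barrier_below
      sink_nonempty sink_closed sink_bounded basin_open sink_basin in \<open>auto\<close>)

lemma ancient_eq_iff: "x \<in> ancient T \<Longrightarrow> y \<in> ancient T \<Longrightarrow> h x = h y \<longleftrightarrow> x = y"
  using inj_h by (auto simp: inj_on_def)

lemma less_image_iff: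
  assumes "x \<in> ancient T" "y \<in> ancient T"
  shows "h (T x) < h (T y) \<longleftrightarrow> h x < h y"
  using assms strict_mono_T ancient_eq_iff
  by (metis linorder_neqE_linordered_idom not_less_iff_gr_or_eq)

lemma less_funpow_iff:
  assumes "x \<in> ancient T" "y \<in> ancient T"
  shows "h ((T ^^ n) x) < h ((T ^^ n) y) \<longleftrightarrow> h x < h y"
  using assms by (induction n) (auto simp: less_image_iff ancient_funpow)

text \<open>
  The set of limits of \<open>(T ^^ m k) (u (r k))\<close> with \<open>m k \<rightarrow> \<infinity>\<close> along admissible segments is contained in
  \<open>B\<close>, and stopping each segment one step earlier shows that every such limit has a preimage of the
  same kind. Choosing preimages successively yields the backward orbit.
\<close>

lemma limit_backward_orbit:
  assumes B: "closed B" "bounded B" and n: "filterlim n at_top sequentially"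
    and u: "\<forall>k. \<forall>j\<le>n k. (T ^^ j) (u k) \<in> B"
  obtains r z where "strict_mono (r :: nat \<Rightarrow> nat)"
    "(\<lambda>k. (T ^^ n (r k)) (u (r k))) \<longlonglongrightarrow> z 0" "backward_orbit T z" "range z \<subseteq> B"
proof -
  \<comment> \<open>\<open>r\<close> need not be increasing here: only the lengths \<open>m k\<close> have to diverge.\<close>
  define Q where "Q x \<longleftrightarrow> (\<exists>r m. (\<forall>k. m k \<le> n (r k)) \<and> filterlim m at_top sequentially \<and>
    (\<lambda>k. (T ^^ m k) (u (r k))) \<longlonglongrightarrow> x)" for x
  have QB: "x \<in> B" if Q: "Q x" for x
  proof -
    obtain r m where "\<forall>k. m k \<le> n (r k)" and lim: "(\<lambda>k. (T ^^ m k) (u (r k))) \<longlonglongrightarrow> x"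
      using Q unfolding Q_def by blast
    then show ?thesis using closed_sequentially[OF B(1) _ lim] u by blast
  qed
  have step: "\<exists>y. Q y \<and> T y = x" if Q: "Q x" for x
  proof -
    obtain r m where m: "\<forall>k. m k \<le> n (r k)" "filterlim m at_top sequentially"
      and lim: "(\<lambda>k. (T ^^ m k) (u (r k))) \<longlonglongrightarrow> x" using Q unfolding Q_def by blast
    have m1: "filterlim (\<lambda>k. m k - 1) at_top sequentially"
      unfolding filterlim_at_top
    proof
      fix Z show "\<forall>\<^sub>F k in sequentially. Z \<le> m k - 1"
        using m(2)[unfolded filterlim_at_top, rule_format, of "Z + 1"] by eventually_elim auto
    qed
    have inB: "\<forall>k. \<forall>j\<le>m k - 1. (T ^^ j) (u (r k)) \<in> B"
      using u m(1) by (meson diff_le_self le_trans)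
    obtain s y where s: "strict_mono (s :: nat \<Rightarrow> nat)"
      and y: "(\<lambda>k. (T ^^ (m (s k) - 1)) (u (r (s k)))) \<longlonglongrightarrow> y"
      using asymp_compact[OF B(2) m1 inB] by blast
    have "filterlim (\<lambda>k. m (s k) - 1) at_top sequentially"
      using filterlim_compose[OF m1 filterlim_subseq[OF s]] .
    moreover have "\<forall>k. m (s k) - 1 \<le> n (r (s k))" using m(1) le_trans[OF diff_le_self] by blast
    ultimately have "Q y" unfolding Q_def using y
      by - (rule exI[of _ "\<lambda>k. r (s k)"], rule exI[of _ "\<lambda>k. m (s k) - 1"], simp)
    moreover have "T y = x"
    proof (rule LIMSEQ_unique)
      have "\<forall>\<^sub>F k in sequentially. 1 \<le> m (s k)"
        using filterlim_compose[OF m(2) filterlim_subseq[OF s]] by (simp add: filterlim_at_top)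
      then have ev: "\<forall>\<^sub>F k in sequentially. T ((T ^^ (m (s k) - 1)) (u (r (s k)))) =
          (T ^^ m (s k)) (u (r (s k)))"
      proof eventually_elim
        case (elim k)
        then show ?case by (cases "m (s k)") auto
      qed
      show "(\<lambda>k. (T ^^ m (s k)) (u (r (s k)))) \<longlonglongrightarrow> T y"
        using Lim_transform_eventually[OF tendsto_T[OF y] ev] .
      show "(\<lambda>k. (T ^^ m (s k)) (u (r (s k)))) \<longlonglongrightarrow> x"
        using LIMSEQ_subseq_LIMSEQ[OF lim s] by (simp add: o_def)
    qed
    ultimately show ?thesis by blast
  qed
  obtain r x where r: "strict_mono (r :: nat \<Rightarrow> nat)"
    and x: "(\<lambda>k. (T ^^ n (r k)) (u (r k))) \<longlonglongrightarrow> x"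
    using asymp_compact[OF B(2) n u] by blast
  have "Q x" unfolding Q_def
    using x filterlim_compose[OF n filterlim_subseq[OF r]]
    by - (rule exI[of _ r], rule exI[of _ "\<lambda>k. n (r k)"], simp)
  then have "\<exists>z. \<forall>j. (Q (z j) \<and> (j = 0 \<longrightarrow> z j = x)) \<and> T (z (Suc j)) = z j"
    by (intro dependent_nat_choice) (use step in auto)
  then obtain z where z: "\<And>j. Q (z j)" "z 0 = x" "\<And>j. T (z (Suc j)) = z j" by blast
  have "range z \<subseteq> B" using QB z(1) by blast
  moreover from this have "backward_orbit T z"
    unfolding backward_orbit_def using z(3) B(2) bounded_subset by blast
  ultimately show ?thesis using that r x z(2) by blast
qed

text \<open>
  A relatively compact sequence whose heights converge can accumulate at only one ancient point, because
  \<open>h\<close> determines ancient points.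
\<close>

lemma convergent_by_height:
  assumes lim: "\<And>s. strict_mono (s :: nat \<Rightarrow> nat) \<Longrightarrow>
      \<exists>r l. strict_mono (r :: nat \<Rightarrow> nat) \<and> (\<lambda>k. x (s (r k))) \<longlonglongrightarrow> l \<and> l \<in> ancient T"
    and c: "(\<lambda>k. h (x k)) \<longlonglongrightarrow> c"
  obtains l where "l \<in> ancient T" "x \<longlonglongrightarrow> l" "h l = c"
proof -
  have height: "h l = c" if "strict_mono s" "strict_mono r" "(\<lambda>k. x (s (r k))) \<longlonglongrightarrow> l"
    for s r :: "nat \<Rightarrow> nat" and l
  proof (rule LIMSEQ_unique)
    show "(\<lambda>k. h (x (s (r k)))) \<longlonglongrightarrow> h l" using that tendsto_h by blast
    show "(\<lambda>k. h (x (s (r k)))) \<longlonglongrightarrow> c"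
      using LIMSEQ_subseq_LIMSEQ[OF LIMSEQ_subseq_LIMSEQ[OF c that(1)] that(2)] by (simp add: o_def)
  qed
  obtain r l where l: "strict_mono r" "(\<lambda>k. x (id (r k))) \<longlonglongrightarrow> l" "l \<in> ancient T"
    using lim[OF strict_mono_id] by blast
  have hl: "h l = c" using height[OF strict_mono_id l(1,2)] .
  have "x \<longlonglongrightarrow> l"
  proof (rule ccontr)
    assume "\<not> x \<longlonglongrightarrow> l"
    then obtain e where e: "e > 0" "\<not> (\<forall>\<^sub>F k in sequentially. dist (x k) l < e)"
      unfolding tendsto_iff by blast
    then obtain s :: "nat \<Rightarrow> nat" where s: "strict_mono s" "\<And>k. \<not> dist (x (s k)) l < e"
      using not_eventually_sequentiallyD[of "\<lambda>k. dist (x k) l < e"] by blast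
    obtain r' l' where l': "strict_mono r'" "(\<lambda>k. x (s (r' k))) \<longlonglongrightarrow> l'" "l' \<in> ancient T"
      using lim[OF s(1)] by blast
    have "l' = l" using height[OF s(1) l'(1,2)] hl l(3) l'(3) ancient_eq_iff by metis
    then have "\<forall>\<^sub>F k in sequentially. dist (x (s (r' k))) l < e"
      using l'(2) e(1) by (simp add: tendsto_iff)
    then show False using s(2) by (auto dest: eventually_happens)
  qed
  then show ?thesis using that l(3) hl by blast
qed

text \<open>
  A point and its image are both ancient, so the sign of the first height increment is transported along the orbit.
\<close>

lemma backward_orbit_monoseq:
  assumes z: "backward_orbit T z"
  shows "(\<forall>j. h (z (Suc j)) \<le> h (z j)) \<or> (\<forall>j. h (z j) \<le> h (z (Suc j)))"
proof -
  have Tz: "T (z (Suc j)) = z j" for j using z by (simp add: backward_orbit_def)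
  have A: "z j \<in> ancient T" for j using backward_orbit_ancient[OF z] .
  have "h (z (Suc j)) < h (z j) \<longleftrightarrow> h (z (Suc 0)) < h (z 0)" for j
  proof (induction j)
    case (Suc j)
    then show ?case using less_image_iff[OF A A, of "Suc (Suc j)" "Suc j"] by (simp add: Tz)
  qed simp
  then show ?thesis by (meson le_less_linear less_imp_le)
qed

lemma backward_orbit_converges:
  assumes z: "backward_orbit T z"
  obtains l where "T l = l" "z \<longlonglongrightarrow> l"
proof -
  have bnd: "bounded (range z)" and Tz: "\<And>j. T (z (Suc j)) = z j"
    using z by (auto simp: backward_orbit_def)
  have "monoseq (\<lambda>j. h (z j))" using backward_orbit_monoseq[OF z] by (auto simp: monoseq_Suc)
  moreover have "Bseq (\<lambda>j. h (z j))"
    using bounded_h[OF bnd] by (simp add: Bseq_eq_bounded image_image)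
  ultimately obtain c where c: "(\<lambda>j. h (z j)) \<longlonglongrightarrow> c"
    using Bseq_monoseq_convergent convergent_def by blast
  have sub: "\<exists>r l. strict_mono (r :: nat \<Rightarrow> nat) \<and> (\<lambda>k. z (s (r k))) \<longlonglongrightarrow> l \<and> l \<in> ancient T"
    if s: "strict_mono s" for s :: "nat \<Rightarrow> nat"
  proof -
    \<comment> \<open>The point \<open>z (s k)\<close> is the end of an orbit segment of length \<open>k\<close> inside \<open>range z\<close>.\<close>
    have "(T ^^ j) (z (k + s k)) \<in> closure (range z)" if "j \<le> k" for j k
    proof -
      have "(T ^^ j) (z (k + s k)) = z (k - j + s k)"
        using backward_orbit_funpow[OF z, of j "k - j + s k"] that by simp
      then show ?thesis using closure_subset[of "range z"] by auto
    qed
    then have orb: "\<forall>k. \<forall>j\<le>k. (T ^^ j) (z (k + s k)) \<in> closure (range z)" by blast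
    obtain r y where "strict_mono r" "(\<lambda>k. (T ^^ (r k)) (z (r k + s (r k)))) \<longlonglongrightarrow> y 0"
      "backward_orbit T y"
      using limit_backward_orbit[OF closed_closure bounded_closure[OF bnd] filterlim_ident orb] .
    then show ?thesis using backward_orbit_funpow[OF z] backward_orbit_ancient[of T y 0]
      by (intro exI[of _ r] exI[of _ "y 0"]) simp
  qed
  obtain l where l: "z \<longlonglongrightarrow> l" using convergent_by_height[OF sub c] by blast
  have "(\<lambda>j. T (z (Suc j))) \<longlonglongrightarrow> T l" using l tendsto_T LIMSEQ_Suc by blast
  then have "T l = l" using l LIMSEQ_unique by (simp add: Tz)
  then show ?thesis using that l by blast
qed

lemma forward_orbit_bounded:
  assumes "v \<in> U"
  shows "bounded (range (\<lambda>n. (T ^^ n) v))"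
proof -
  obtain n0 where n0: "\<And>n. n \<ge> n0 \<Longrightarrow> (T ^^ n) v \<in> S" using attracted[OF assms] by blast
  have "range (\<lambda>n. (T ^^ n) v) \<subseteq> (\<lambda>n. (T ^^ n) v) ` {..<n0} \<union> S"
    using n0 by (fastforce simp: not_less[symmetric])
  moreover have "bounded ((\<lambda>n. (T ^^ n) v) ` {..<n0} \<union> S)"
    using sink_bounded by (simp add: finite_imp_bounded)
  ultimately show ?thesis using bounded_subset by blast
qed

lemma forward_orbit_subseq:
  assumes v: "v \<in> U" and s: "strict_mono (s :: nat \<Rightarrow> nat)"
  obtains r l where "strict_mono (r :: nat \<Rightarrow> nat)" "(\<lambda>k. (T ^^ s (r k)) v) \<longlonglongrightarrow> l"
    "l \<in> ancient T" "l \<in> S"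
proof -
  define B where "B = closure (range (\<lambda>n. (T ^^ n) v))"
  have B: "closed B" "bounded B" using forward_orbit_bounded[OF v] by (auto simp: B_def)
  have inB: "\<forall>k. \<forall>j\<le>s k. (T ^^ j) v \<in> B"
    unfolding B_def by (auto intro: subsetD[OF closure_subset])
  obtain r z where r: "strict_mono r" "(\<lambda>k. (T ^^ s (r k)) v) \<longlonglongrightarrow> z 0" "backward_orbit T z"
    using limit_backward_orbit[OF B filterlim_subseq[OF s] inB] .
  obtain n0 where n0: "\<And>n. n \<ge> n0 \<Longrightarrow> (T ^^ n) v \<in> S" using attracted[OF v] by blast
  have "filterlim (\<lambda>k. s (r k)) at_top sequentially"
    using filterlim_compose[OF filterlim_subseq[OF s] filterlim_subseq[OF r(1)]] .
  then have "\<forall>\<^sub>F k in sequentially. n0 \<le> s (r k)" by (simp add: filterlim_at_top)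
  then have "\<forall>\<^sub>F k in sequentially. (T ^^ s (r k)) v \<in> S" by eventually_elim (use n0 in auto)
  then have "z 0 \<in> S" using Lim_in_closed_set[OF sink_closed _ _ r(2)] by simp
  then show ?thesis using that r backward_orbit_ancient by blast
qed

definition fixed_points :: "'a set" where
  "fixed_points = {p \<in> S. T p = p}"

lemma fixed_points_basin:
  assumes "T p = p" "p \<in> U"
  shows "p \<in> fixed_points"
  using attracted[OF assms(2)] fixed_funpow[of T p] assms by (auto simp: fixed_points_def)

lemma fixed_points_ancient: "p \<in> fixed_points \<Longrightarrow> p \<in> ancient T"
  by (simp add: fixed_points_def fixed_ancient)

lemma forward_orbit_converges:
  assumes x: "x \<in> ancient T" "x \<in> U"
  obtains f where "f \<in> fixed_points" "(\<lambda>n. (T ^^ n) x) \<longlonglongrightarrow> f" "h x < h (T x) \<longrightarrow> h x < h f"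
proof -
  let ?x = "\<lambda>n. (T ^^ n) x"
  have A: "?x n \<in> ancient T" for n using x(1) ancient_funpow by blast
  have up: "h (?x n) < h (?x (Suc n)) \<longleftrightarrow> h x < h (T x)" for n
    using less_funpow_iff[OF x(1) ancient_image[OF x(1)], of n] by (simp add: funpow_swap1)
  then have mono: "monoseq (\<lambda>n. h (?x n))" unfolding monoseq_Suc by (meson le_less_linear less_imp_le)
  moreover have "Bseq (\<lambda>n. h (?x n))"
    using bounded_h[OF forward_orbit_bounded[OF x(2)]] by (simp add: Bseq_eq_bounded image_image)
  ultimately obtain c where c: "(\<lambda>n. h (?x n)) \<longlonglongrightarrow> c"
    using Bseq_monoseq_convergent convergent_def by blast
  have sub: "\<exists>r l. strict_mono (r :: nat \<Rightarrow> nat) \<and> (\<lambda>k. ?x (s (r k))) \<longlonglongrightarrow> l \<and> l \<in> ancient T"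
    if "strict_mono s" for s :: "nat \<Rightarrow> nat"
    using forward_orbit_subseq[OF x(2) that] by metis
  obtain f where f: "?x \<longlonglongrightarrow> f" "h f = c" using convergent_by_height[OF sub c] by blast
  have "(\<lambda>n. T (?x n)) \<longlonglongrightarrow> f" using LIMSEQ_Suc[OF f(1)] by simp
  then have Tf: "T f = f" using LIMSEQ_unique tendsto_T[OF f(1)] by blast
  obtain n0 where n0: "\<And>n. n \<ge> n0 \<Longrightarrow> ?x n \<in> S" using attracted[OF x(2)] by blast
  then have "f \<in> S"
    using Lim_in_closed_set[OF sink_closed _ _ f(1)] eventually_sequentiallyI[of n0] by simp
  moreover have "h x < h f" if xT: "h x < h (T x)"
  proof -
    have "incseq (\<lambda>n. h (?x n))" using up xT by (intro incseq_SucI less_imp_le) auto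
    from incseq_le[OF this tendsto_h[OF f(1)], of 1] show ?thesis using xT by simp
  qed
  ultimately show ?thesis using that f(1) Tf by (simp add: fixed_points_def)
qed

lemma fixed_points_nonempty: "fixed_points \<noteq> {}"
proof -
  obtain v where "v \<in> U" using sink_nonempty sink_basin by blast
  then obtain l where "l \<in> ancient T" "l \<in> U"
    using forward_orbit_subseq[OF _ strict_mono_id] sink_basin by blast
  then show ?thesis using forward_orbit_converges by blast
qed

lemma fixed_points_compact: "compact fixed_points"
proof -
  have "\<exists>l\<in>fixed_points. \<exists>r. strict_mono r \<and> (f \<circ> r) \<longlonglongrightarrow> l" if "\<forall>k. f k \<in> fixed_points"
    for f :: "nat \<Rightarrow> 'a"
  proof -
    have f: "f k \<in> S" "T (f k) = f k" for k using that by (auto simp: fixed_points_def)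
    then obtain r l where r: "strict_mono (r :: nat \<Rightarrow> nat)" "(\<lambda>k. (T ^^ r k) (f (r k))) \<longlonglongrightarrow> l"
      using asymp_compact[OF sink_bounded filterlim_ident, of f] by (auto simp: fixed_funpow)
    then have lim: "(\<lambda>k. f (r k)) \<longlonglongrightarrow> l" using f(2) by (simp add: fixed_funpow)
    have "l \<in> S" using closed_sequentially[OF sink_closed _ lim] f(1) by blast
    moreover have "T l = l" using tendsto_T[OF lim] f(2) lim LIMSEQ_unique by simp
    ultimately show ?thesis using r(1) lim by (auto simp: fixed_points_def o_def)
  qed
  then show ?thesis by (simp add: compact_eq_seq_compact_metric seq_compact_def)
qed

text \<open>
  The analogue of a fixed point of an increasing map on the line that is unstable from one side. It is witnessed
  by a single emanating orbit, because only such orbits consist of ancient points and can be compared by height.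
\<close>

definition repels_above :: "'a \<Rightarrow> bool" where
  "repels_above p \<longleftrightarrow> (\<exists>z. backward_orbit T z \<and> z \<longlonglongrightarrow> p \<and> h p < h (z 0))"

definition repels_below :: "'a \<Rightarrow> bool" where
  "repels_below p \<longleftrightarrow> (\<exists>z. backward_orbit T z \<and> z \<longlonglongrightarrow> p \<and> h (z 0) < h p)"

text \<open>
  Let \<open>z\<close> emanate from \<open>p\<close> upwards. It increases in forward time and converges to a fixed point \<open>f\<close>.
  A fixed point \<open>g\<close> above \<open>p\<close> lies above \<open>z j\<close> for large \<open>j\<close>, hence above the whole forward orbit, so
  \<open>f\<close> is the immediate successor of \<open>p\<close>. An orbit \<open>y\<close> emanating from \<open>f\<close> downwards would start above
  a fixed \<open>z J\<close> and stay above its forward orbit, which climbs to \<open>f\<close>; so it could not descend.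
\<close>

lemma repels_above_successor:
  assumes p: "p \<in> fixed_points" "repels_above p"
  obtains f where "f \<in> fixed_points" "h p < h f" "\<And>g. g \<in> fixed_points \<Longrightarrow> h p < h g \<Longrightarrow> h f \<le> h g"
    "\<not> repels_below f"
proof -
  obtain z where z: "backward_orbit T z" "z \<longlonglongrightarrow> p" and z0: "h p < h (z 0)"
    using p(2) by (auto simp: repels_above_def)
  have A: "z j \<in> ancient T" for j using backward_orbit_ancient[OF z(1)] .
  have pA: "p \<in> ancient T" and Tp: "T p = p" and "p \<in> U"
    using p(1) fixed_points_ancient sink_basin by (auto simp: fixed_points_def)
  have above: "h p < h (z j)" for j
    using less_funpow_iff[OF pA A, of j j] backward_orbit_funpow[OF z(1), of j 0] z0 Tp
    by (simp add: fixed_funpow)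
  obtain J where J: "z J \<in> U"
    using topological_tendstoD[OF z(2) basin_open \<open>p \<in> U\<close>] eventually_sequentially by auto
  have up: "h (z J) < h (T (z J))"
  proof -
    have "\<exists>j. h (z (Suc j)) < h (z j)"
    proof (rule ccontr)
      assume "\<not> ?thesis"
      then have "incseq (\<lambda>j. h (z j))" by (intro incseq_SucI) (simp add: not_less)
      from incseq_le[OF this tendsto_h[OF z(2)], of 0] show False using z0 by simp
    qed
    then obtain j where "h (z (Suc j)) < h (T (z (Suc j)))" using z(1) by (auto simp: backward_orbit_def)
    moreover have "h (z i) < h (T (z i)) \<longleftrightarrow> h (z 0) < h (T (z 0))" for i
      using less_funpow_iff[OF A ancient_image[OF A], of i i i] backward_orbit_funpow[OF z(1), of i 0]
      by (metis add.right_neutral funpow_swap1)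
    ultimately show ?thesis by blast
  qed
  obtain f where f: "f \<in> fixed_points" "(\<lambda>n. (T ^^ n) (z J)) \<longlonglongrightarrow> f" "h (z J) < h f"
    using forward_orbit_converges[OF A J] up by blast
  have "h f \<le> h g" if g: "g \<in> fixed_points" "h p < h g" for g
  proof -
    have "\<forall>\<^sub>F j in sequentially. h (z j) < h g" using order_tendstoD(2)[OF tendsto_h[OF z(2)] g(2)] .
    then obtain i where i: "h (z (i + J)) < h g"
      using eventually_sequentially by (metis (full_types) le_add1)
    have gA: "g \<in> ancient T" and Tg: "T g = g"
      using g(1) fixed_points_ancient by (auto simp: fixed_points_def)
    have "h (z J) < h g"
      using less_funpow_iff[OF A gA, of i "i + J"] i backward_orbit_funpow[OF z(1)] Tg
      by (simp add: fixed_funpow)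
    then have "h ((T ^^ n) (z J)) \<le> h g" for n
      using less_funpow_iff[OF A gA, of n J] Tg by (simp add: fixed_funpow)
    then show ?thesis using LIMSEQ_le_const2[OF tendsto_h[OF f(2)]] by blast
  qed
  moreover have "\<not> repels_below f"
  proof
    assume "repels_below f"
    then obtain y where y: "backward_orbit T y" "y \<longlonglongrightarrow> f" "h (y 0) < h f"
      by (auto simp: repels_below_def)
    have "\<forall>\<^sub>F j in sequentially. h (z J) < h (y j)"
      using order_tendstoD(1)[OF tendsto_h[OF y(2)] f(3)] .
    \<comment> \<open>Apply \<open>T ^^ j\<close> to \<open>h (z J) < h (y j)\<close>: the right end is always \<open>y 0\<close>.\<close>
    then have "\<forall>\<^sub>F j in sequentially. h ((T ^^ j) (z J)) \<le> h (y 0)"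
    proof eventually_elim
      case (elim j)
      then show ?case
        using less_funpow_iff[OF A backward_orbit_ancient[OF y(1)], of j J j]
          backward_orbit_funpow[OF y(1), of j 0] by simp
    qed
    then have "h f \<le> h (y 0)"
      using tendsto_upperbound[OF tendsto_h[OF f(2)]] by simp
    then show False using y(3) by simp
  qed
  ultimately show ?thesis using that f above[of J] by (meson less_trans)
qed

lemma repels_below_predecessor:
  assumes p: "p \<in> fixed_points" "repels_below p"
  obtains f where "f \<in> fixed_points" "h f < h p" "\<not> repels_above f"
proof -
  interpret rev: monotone_on_ancient T "\<lambda>x. - h x" S U by (rule reversed)
  have "rev.repels_above = repels_below" "rev.repels_below = repels_above"
    by (auto simp: fun_eq_iff rev.repels_above_def repels_above_def rev.repels_below_def repels_below_def)
  then show ?thesis using rev.repels_above_successor[of p] p that by auto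
qed

text \<open>
  The backward orbit \<open>z\<close> converges to a fixed point in the ball that is not below \<open>p\<close>. If fixed points
  accumulate at \<open>p\<close> from above, they squeeze \<open>z 0\<close> down to the height of \<open>p\<close>, which is impossible; otherwise the ball contains no fixed
  point above \<open>p\<close>, so that the limit is \<open>p\<close> itself.
\<close>

lemma escaping_limit_repels_above:
  assumes p: "p \<in> fixed_points" and ball: "cball p \<epsilon> \<subseteq> U"
    and isolated: "p \<in> closure {f \<in> fixed_points. h p < h f} \<or> cball p \<epsilon> \<inter> {f \<in> fixed_points. h p < h f} = {}"
    and z: "backward_orbit T z" "range z \<subseteq> cball p \<epsilon>" and above: "h p < h (z 0)"
    and below: "\<And>f. f \<in> fixed_points \<Longrightarrow> h p < h f \<Longrightarrow> h (z 0) \<le> h f"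
  shows "repels_above p"
proof -
  have Tp: "T p = p" and pA: "p \<in> ancient T"
    using p fixed_points_ancient by (auto simp: fixed_points_def)
  have "p \<notin> closure {f \<in> fixed_points. h p < h f}"
  proof
    assume "p \<in> closure {f \<in> fixed_points. h p < h f}"
    then obtain x where x: "\<And>n. x n \<in> fixed_points" "\<And>n. h p < h (x n)" "x \<longlonglongrightarrow> p"
      by (auto simp: closure_sequential)
    then have "h (z 0) \<le> h p" using LIMSEQ_le_const[OF tendsto_h[OF x(3)]] below by blast
    then show False using above by simp
  qed
  then have isol: "cball p \<epsilon> \<inter> {f \<in> fixed_points. h p < h f} = {}" using isolated by blast
  obtain l where l: "T l = l" "z \<longlonglongrightarrow> l" using backward_orbit_converges[OF z(1)] .
  have lb: "l \<in> cball p \<epsilon>" using closed_sequentially[OF closed_cball _ l(2)] z(2) by blast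
  then have lF: "l \<in> fixed_points" using l(1) ball fixed_points_basin by blast
  have "h p < h (z j)" for j
    using less_funpow_iff[OF pA backward_orbit_ancient[OF z(1)], of j j]
      backward_orbit_funpow[OF z(1), of j 0] above Tp by (simp add: fixed_funpow)
  then have "h p \<le> h l" using LIMSEQ_le_const[OF tendsto_h[OF l(2)]] by (meson less_imp_le)
  then have "h l = h p" using isol lb lF by force
  then have "l = p" using ancient_eq_iff[OF fixed_points_ancient[OF lF] pA] by simp
  then show ?thesis using z(1) l(2) above by (auto simp: repels_above_def)
qed

text \<open>
  The radius serves for all smaller balls as well, because it will be combined with other smallness conditions.
\<close>

lemma isolating_radius:
  fixes C :: "'a set"
  shows "\<exists>e>0. p \<in> closure C \<or> (\<forall>e'\<le>e. cball p e' \<inter> C = {})"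
proof (cases "p \<in> closure C")
  case False
  then obtain e where "e > 0" "\<And>y. y \<in> C \<Longrightarrow> e \<le> dist y p"
    by (auto simp: closure_approachable not_less)
  then show ?thesis by (intro exI[of _ "e / 2"]) (force simp: dist_commute)
qed (auto intro: exI[of _ 1])

text \<open>
  Take initial values tending to \<open>p\<close> whose orbits leave a small ball. By continuity the exit times
  diverge, so the orbit segments before the exit have a limit that ends a backward orbit in the ball. This
  limit is not \<open>p\<close>, since its image is the limit of the exit points. By the barriers it stays
  on the near side of every fixed point on its side of \<open>p\<close>.
\<close>

lemma unstable_repels:
  assumes p: "p \<in> fixed_points"
    and unstable: "\<not> (\<forall>\<epsilon>>0. \<exists>\<delta>>0. \<forall>u. dist u p < \<delta> \<longrightarrow> (\<forall>n. dist ((T ^^ n) u) p < \<epsilon>))"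
  shows "repels_above p \<or> repels_below p"
proof -
  let ?A = "{f \<in> fixed_points. h p < h f}" and ?B = "{f \<in> fixed_points. h f < h p}"
  have Tp: "T p = p" and pA: "p \<in> ancient T" and "p \<in> U"
    using p fixed_points_ancient sink_basin by (auto simp: fixed_points_def)
  obtain e0 where e0: "e0 > 0" "\<And>\<delta>. \<delta> > 0 \<Longrightarrow> \<exists>u. dist u p < \<delta> \<and> (\<exists>n. \<not> dist ((T ^^ n) u) p < e0)"
    using unstable by blast
  obtain e1 where e1: "e1 > 0" "cball p e1 \<subseteq> U"
    using basin_open \<open>p \<in> U\<close> open_contains_cball by blast
  obtain e2 where e2: "e2 > 0" "p \<in> closure ?A \<or> (\<forall>e\<le>e2. cball p e \<inter> ?A = {})"
    using isolating_radius by blast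
  obtain e3 where e3: "e3 > 0" "p \<in> closure ?B \<or> (\<forall>e\<le>e3. cball p e \<inter> ?B = {})"
    using isolating_radius by blast
  define \<epsilon> where "\<epsilon> = Min {e0, e1, e2, e3}"
  have eps: "\<epsilon> > 0" "\<epsilon> \<le> e0" "\<epsilon> \<le> e1" "\<epsilon> \<le> e2" "\<epsilon> \<le> e3"
    using e0(1) e1(1) e2(1) e3(1) by (auto simp: \<epsilon>_def)
  have ball: "cball p \<epsilon> \<subseteq> U" using e1(2) eps(3) by auto
  have "\<exists>u. dist u p < min \<epsilon> (inverse (real (Suc k))) \<and> (\<exists>n. \<not> dist ((T ^^ n) u) p < \<epsilon>)" for k
  proof -
    obtain u n where "dist u p < min \<epsilon> (inverse (real (Suc k)))" "\<not> dist ((T ^^ n) u) p < e0"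
      using e0(2)[of "min \<epsilon> (inverse (real (Suc k)))"] eps(1) by auto
    moreover from this have "\<not> dist ((T ^^ n) u) p < \<epsilon>" using eps(2) by linarith
    ultimately show ?thesis by blast
  qed
  then have "\<forall>k. \<exists>u. dist u p < min \<epsilon> (inverse (real (Suc k))) \<and> (\<exists>n. \<not> dist ((T ^^ n) u) p < \<epsilon>)"
    by blast
  from choice[OF this] obtain u where u: "\<And>k. dist (u k) p < \<epsilon>"
      "\<And>k. dist (u k) p < inverse (real (Suc k))"
    and esc: "\<And>k. \<exists>n. \<not> dist ((T ^^ n) (u k)) p < \<epsilon>" by auto
  have "(\<lambda>k. dist (u k) p) \<longlonglongrightarrow> 0"
  proof (rule real_tendsto_sandwich[OF _ _ tendsto_const LIMSEQ_inverse_real_of_nat])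
    show "\<forall>\<^sub>F k in sequentially. dist (u k) p \<le> inverse (real (Suc k))"
      using u(2) by (intro always_eventually) (simp add: less_imp_le)
  qed simp
  then have ulim: "u \<longlonglongrightarrow> p" by (subst tendsto_dist_iff)
  define m where "m k = (LEAST n. \<not> dist ((T ^^ n) (u k)) p < \<epsilon>)" for k
  have m: "\<not> dist ((T ^^ m k) (u k)) p < \<epsilon>" for k
    unfolding m_def using LeastI_ex[OF esc] by blast
  have before: "dist ((T ^^ j) (u k)) p < \<epsilon>" if "j < m k" for j k
    using not_less_Least[of j "\<lambda>n. \<not> dist ((T ^^ n) (u k)) p < \<epsilon>"] that unfolding m_def by blast
  have mpos: "m k > 0" for k using m[of k] u(1)[of k] by (cases "m k") auto
  \<comment> \<open>The last time inside the ball; the exit point itself may lie outside the region under control.\<close>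
  define n where "n k = m k - 1" for k
  have Sn: "m k = Suc (n k)" for k using mpos[of k] by (simp add: n_def)
  have close: "\<forall>\<^sub>F k in sequentially. dist ((T ^^ j) (u k)) p < \<epsilon>" for j
  proof -
    have "(\<lambda>k. (T ^^ j) (u k)) \<longlonglongrightarrow> (T ^^ j) p"
      using continuous_on_tendsto_compose[OF continuous_funpow[OF continuous_T] ulim] by simp
    then show ?thesis using eps(1) Tp by (simp add: tendsto_iff fixed_funpow)
  qed
  have "filterlim n at_top sequentially"
    unfolding filterlim_at_top
  proof
    fix N
    have "\<forall>\<^sub>F k in sequentially. \<forall>j\<in>{..N}. dist ((T ^^ j) (u k)) p < \<epsilon>"
      using close by (subst eventually_ball_finite_distrib) auto
    then show "\<forall>\<^sub>F k in sequentially. N \<le> n k"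
    proof eventually_elim
      case (elim k)
      then have "\<not> m k \<le> N" using m[of k] by auto
      then show ?case by (simp add: Sn)
    qed
  qed
  moreover have "\<forall>k. \<forall>j\<le>n k. (T ^^ j) (u k) \<in> cball p \<epsilon>"
    using before by (simp add: Sn dist_commute less_imp_le)
  ultimately obtain r z where r: "strict_mono (r :: nat \<Rightarrow> nat)"
    and lim: "(\<lambda>k. (T ^^ n (r k)) (u (r k))) \<longlonglongrightarrow> z 0"
    and z: "backward_orbit T z" "range z \<subseteq> cball p \<epsilon>"
    using limit_backward_orbit[OF closed_cball bounded_cball] by blast
  have "z 0 \<noteq> p"
  proof
    assume "z 0 = p"
    then have "(\<lambda>k. (T ^^ m (r k)) (u (r k))) \<longlonglongrightarrow> p"
      using tendsto_T[OF lim] Tp by (simp add: Sn)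
    then have "\<forall>\<^sub>F k in sequentially. dist ((T ^^ m (r k)) (u (r k))) p < \<epsilon>"
      using eps(1) by (simp add: tendsto_iff)
    then show False using m by (auto dest: eventually_happens)
  qed
  then consider "h p < h (z 0)" | "h (z 0) < h p"
    using ancient_eq_iff[OF backward_orbit_ancient[OF z(1)] pA] by (meson linorder_neqE_linordered_idom)
  then show ?thesis
  proof cases
    case 1
    have "h (z 0) \<le> h f" if f: "f \<in> fixed_points" "h p < h f" for f
    proof -
      obtain \<delta> where d: "\<delta> > 0" "\<And>u n. dist u p < \<delta> \<Longrightarrow> h ((T ^^ n) u) < h f"
        using barrier_above[OF Tp _ f(2)] f(1) by (auto simp: fixed_points_def)
      have "\<forall>\<^sub>F k in sequentially. dist (u (r k)) p < \<delta>"
        using LIMSEQ_subseq_LIMSEQ[OF ulim r] d(1) by (simp add: tendsto_iff o_def)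
      then have "\<forall>\<^sub>F k in sequentially. h ((T ^^ n (r k)) (u (r k))) \<le> h f"
        by eventually_elim (use d(2) in \<open>auto intro: less_imp_le\<close>)
      then show ?thesis using tendsto_upperbound[OF tendsto_h[OF lim]] by simp
    qed
    then show ?thesis using escaping_limit_repels_above[OF p ball _ z 1] e2(2) eps by blast
  next
    case 2
    interpret rev: monotone_on_ancient T "\<lambda>x. - h x" S U by (rule reversed)
    have eq: "rev.repels_above = repels_below"
      by (auto simp: fun_eq_iff rev.repels_above_def repels_below_def)
    have "h f \<le> h (z 0)" if f: "f \<in> fixed_points" "h f < h p" for f
    proof -
      obtain \<delta> where d: "\<delta> > 0" "\<And>u n. dist u p < \<delta> \<Longrightarrow> h f < h ((T ^^ n) u)"
        using barrier_below[OF Tp _ f(2)] f(1) by (auto simp: fixed_points_def)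
      have "\<forall>\<^sub>F k in sequentially. dist (u (r k)) p < \<delta>"
        using LIMSEQ_subseq_LIMSEQ[OF ulim r] d(1) by (simp add: tendsto_iff o_def)
      then have "\<forall>\<^sub>F k in sequentially. h f \<le> h ((T ^^ n (r k)) (u (r k)))"
        by eventually_elim (use d(2) in \<open>auto intro: less_imp_le\<close>)
      then show ?thesis using tendsto_lowerbound[OF tendsto_h[OF lim]] by simp
    qed
    then show ?thesis
      using rev.escaping_limit_repels_above[unfolded eq neg_less_iff_less neg_le_iff_le,
          OF p ball _ z 2] e3(2) eps by blast
  qed
qed

text \<open>
  Among the fixed points that do not repel above (the highest one is of this kind), take the lowest height
  \<open>h p\<close>; the infimum is attained by a fixed point because the set of fixed points is compact. If \<open>p\<close>
  repelled above, all members of \<open>N\<close> would be at least as high as its successor, which exceeds the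
  infimum. If \<open>p\<close> repelled below, its predecessor would be a lower member of \<open>N\<close>.
\<close>

lemma stable_fixed_point:
  obtains p where "T p = p" "\<forall>\<epsilon>>0. \<exists>\<delta>>0. \<forall>u. dist u p < \<delta> \<longrightarrow> (\<forall>n. dist ((T ^^ n) u) p < \<epsilon>)"
proof -
  define N where "N = {p \<in> fixed_points. \<not> repels_above p}"
  have conth: "continuous_on fixed_points h" using continuous_h continuous_on_subset by blast
  have cpt: "compact (h ` fixed_points)" using compact_continuous_image[OF conth fixed_points_compact] .
  obtain M where M: "M \<in> fixed_points" "\<And>f. f \<in> fixed_points \<Longrightarrow> h f \<le> h M"
    using continuous_attains_sup[OF fixed_points_compact fixed_points_nonempty conth] by blast
  have "\<not> repels_above M"
  proof
    assume "repels_above M"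
    then obtain f where "f \<in> fixed_points" "h M < h f"
      using repels_above_successor[OF M(1)] by metis
    then show False using M(2) by fastforce
  qed
  then have "M \<in> N" using M(1) by (simp add: N_def)
  then have ne: "h ` N \<noteq> {}" by blast
  have sub: "h ` N \<subseteq> h ` fixed_points" by (auto simp: N_def)
  have bdd: "bdd_below (h ` N)"
    using bdd_below_mono[OF bounded_imp_bdd_below[OF compact_imp_bounded[OF cpt]] sub] .
  have "Inf (h ` N) \<in> closure (h ` N)" using closure_contains_Inf[OF ne bdd] .
  then have "Inf (h ` N) \<in> h ` fixed_points"
    using closure_minimal[OF sub compact_imp_closed[OF cpt]] by blast
  then obtain p where p: "p \<in> fixed_points" "h p = Inf (h ` N)" by auto
  have low: "h p \<le> h g" if "g \<in> N" for g using p(2) bdd that cInf_lower by (metis imageI)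
  have "\<not> repels_above p"
  proof
    assume rep: "repels_above p"
    then obtain f where f: "h p < h f" "\<And>g. g \<in> fixed_points \<Longrightarrow> h p < h g \<Longrightarrow> h f \<le> h g"
      using repels_above_successor[OF p(1)] by metis
    have "h f \<le> h g" if g: "g \<in> N" for g
    proof -
      have "g \<noteq> p" using rep g by (auto simp: N_def)
      then have "h g \<noteq> h p" using g p(1) ancient_eq_iff fixed_points_ancient by (auto simp: N_def)
      then show ?thesis using low[OF g] f(2)[of g] g by (auto simp: N_def)
    qed
    then have "h f \<le> h p" using cInf_greatest[OF ne] p(2) by auto
    then show False using f(1) by simp
  qed
  moreover have "\<not> repels_below p"
  proof
    assume "repels_below p"
    then obtain f where "f \<in> N" "h f < h p" using repels_below_predecessor[OF p(1)] by (auto simp: N_def)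
    then show False using low by fastforce
  qed
  ultimately have "\<forall>\<epsilon>>0. \<exists>\<delta>>0. \<forall>u. dist u p < \<delta> \<longrightarrow> (\<forall>n. dist ((T ^^ n) u) p < \<epsilon>)"
    using unstable_repels[OF p(1)] by blast
  then show ?thesis using that[of p] p(1) by (simp add: fixed_points_def)
qed

end

section \<open>Measure of noncompactness and convergent subsequences\<close>

lemma convergent_subseq_of_totally_bounded:
  fixes x :: "nat \<Rightarrow> 'a::complete_space"
  assumes tot: "\<And>e. e > 0 \<Longrightarrow> \<exists>F. finite F \<and> range x \<subseteq> (\<Union>a\<in>F. cball a e)"
  shows "\<exists>r l. strict_mono (r :: nat \<Rightarrow> nat) \<and> (\<lambda>k. x (r k)) \<longlonglongrightarrow> l"
proof -
  have "compact (closure (range x))"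
    unfolding compact_eq_totally_bounded
  proof (intro conjI allI impI)
    show "complete (closure (range x))" by (simp add: complete_eq_closed)
    fix e :: real assume e: "e > 0"
    then obtain F where F: "finite F" "range x \<subseteq> (\<Union>a\<in>F. cball a (e / 2))"
      using tot[of "e / 2"] by auto
    have "closure (range x) \<subseteq> (\<Union>a\<in>F. cball a (e / 2))"
      using F by (intro closure_minimal closed_UN) auto
    also have "\<dots> \<subseteq> (\<Union>a\<in>F. ball a e)" using e by auto
    finally show "\<exists>F. finite F \<and> closure (range x) \<subseteq> (\<Union>a\<in>F. ball a e)" using F(1) by blast
  qed
  then have "seq_compact (closure (range x))" by (simp add: compact_eq_seq_compact_metric)
  moreover have "\<forall>n. x n \<in> closure (range x)" by (auto intro: subsetD[OF closure_subset])
  ultimately obtain l r where "strict_mono (r :: nat \<Rightarrow> nat)" "(x \<circ> r) \<longlonglongrightarrow> l"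
    unfolding seq_compact_def by metis
  then show ?thesis by (auto simp: o_def)
qed

lemma kuratowski_measure_le_diameter:
  assumes "bounded B"
  shows "kuratowski_measure B \<le> ennreal (diameter B)"
proof -
  have "\<exists>F. finite F \<and> B \<subseteq> \<Union>F \<and> (\<forall>A\<in>F. bounded A \<and> diameter A \<le> diameter B)"
    using assms by (intro exI[of _ "{B}"]) simp
  then show ?thesis
    unfolding kuratowski_measure_def using diameter_ge_0[OF assms] by (intro Inf_lower) blast
qed

lemma kuratowski_measure_less_cover:
  assumes "kuratowski_measure B < ennreal e"
  obtains F where "finite F" "B \<subseteq> (\<Union>a\<in>F. cball a e)"
proof -
  obtain d G where d: "ennreal d < ennreal e" "d \<ge> 0"
    and G: "finite G" "B \<subseteq> \<Union>G" "\<And>A. A \<in> G \<Longrightarrow> bounded A \<and> diameter A \<le> d"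
    using assms unfolding kuratowski_measure_def Inf_less_iff by blast
  have de: "d \<le> e" using d ennreal_less_iff by fastforce
  have "B \<subseteq> (\<Union>a\<in>(\<lambda>A. SOME a. a \<in> A) ` G. cball a e)"
  proof
    fix b assume "b \<in> B"
    then obtain A where A: "A \<in> G" "b \<in> A" using G(2) by blast
    then have "(SOME a. a \<in> A) \<in> A" by (metis someI)
    then have "dist (SOME a. a \<in> A) b \<le> e"
      using diameter_bounded_bound[of A] G(3)[OF A(1)] A(2) de by (meson order_trans)
    then show "b \<in> (\<Union>a\<in>(\<lambda>A. SOME a. a \<in> A) ` G. cball a e)" using A(1) by auto
  qed
  then show ?thesis using that G(1) by blast
qed

section \<open>Squeezing and the order on ancient points\<close>

text \<open>
  The functional \<open>h\<close> is the coordinate along the negative line. Its kernel is the positive subspace,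
  whence the sign condition, so \<open>V (x - y) < 0\<close> forces \<open>x\<close> and \<open>y\<close> to have different heights.
\<close>

locale squeezed_cocycle =
  fixes \<theta> :: "real \<Rightarrow> 'q::metric_space \<Rightarrow> 'q"
    and \<psi> :: "real \<Rightarrow> 'q \<Rightarrow> 'a::banach \<Rightarrow> 'a"
    and J :: "'a \<Rightarrow>\<^sub>L 'h::real_normed_vector"
    and V :: "'a \<Rightarrow> real" and h :: "'a \<Rightarrow> real"
    and \<sigma> \<nu>m \<nu>p :: real and \<nu>0 :: "'q \<Rightarrow> real" and S :: "'a set" and q :: 'q
  assumes period_pos: "\<sigma> > 0"
    and flow: "minimal_periodic_flow \<sigma> \<theta>"
    and cocycle: "cocycle \<theta> \<psi>"
    and inj_J: "inj (blinfun_apply J)"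
    and continuous_V: "continuous_on UNIV V"
    and V_growth: "\<exists>M. \<forall>v. V v \<le> M * (norm v)\<^sup>2"
    and linear_h: "bounded_linear h"
    and kernel_h: "h v = 0 \<Longrightarrow> 0 \<le> V v"
    and squeezing: "squeezing_property \<theta> \<psi> J V \<nu>m \<nu>p \<nu>0"
    and continuous_\<nu>0: "continuous_on UNIV \<nu>0"
    and rate_pos: "\<nu>m > 0"
    and compactness: "asymptotically_compact \<nu>p \<psi>"
    and lipschitz: "uniform_lipschitz_property \<psi> J"
    and sink: "sink \<psi> S"
begin

definition T :: "'a \<Rightarrow> 'a" where "T = \<psi> \<sigma> q"

definition E :: "real \<Rightarrow> real" where "E t = exponent_integral \<theta> \<nu>0 t q"

lemma \<theta>_add: "\<theta> (t + s) p = \<theta> t (\<theta> s p)"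
  using flow unfolding minimal_periodic_flow_def by blast

lemma \<theta>_periods: "\<theta> (real n * \<sigma>) p = p"
proof (induction n)
  case 0
  then show ?case using flow by (simp add: minimal_periodic_flow_def)
next
  case (Suc n)
  have "\<theta> (real (Suc n) * \<sigma>) p = \<theta> (real n * \<sigma>) (\<theta> \<sigma> p)"
    using \<theta>_add[of "real n * \<sigma>" \<sigma> p] by (simp add: algebra_simps)
  then show ?case using Suc flow by (simp add: minimal_periodic_flow_def)
qed

lemma \<theta>_shift_periods: "\<theta> (t + real n * \<sigma>) p = \<theta> t p"
  by (simp add: \<theta>_add \<theta>_periods)

lemma \<psi>_0: "\<psi> 0 p v = v"
  using cocycle by (simp add: cocycle_def)

lemma \<psi>_add: "t \<ge> 0 \<Longrightarrow> s \<ge> 0 \<Longrightarrow> \<psi> (t + s) p v = \<psi> t (\<theta> s p) (\<psi> s p v)"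
  using cocycle by (simp add: cocycle_def)

lemma T_funpow: "(T ^^ n) v = \<psi> (real n * \<sigma>) q v"
proof (induction n)
  case (Suc n)
  have "(T ^^ Suc n) v = \<psi> \<sigma> (\<theta> (real n * \<sigma>) q) (\<psi> (real n * \<sigma>) q v)"
    using Suc by (simp add: T_def \<theta>_periods)
  also have "\<dots> = \<psi> (\<sigma> + real n * \<sigma>) q v"
    using period_pos by (subst \<psi>_add) auto
  finally show ?case by (simp add: algebra_simps)
qed (simp add: \<psi>_0)

lemma \<psi>_shift_periods: "t \<ge> 0 \<Longrightarrow> \<psi> (t + real n * \<sigma>) q v = \<psi> t q ((T ^^ n) v)"
  using period_pos by (simp add: \<psi>_add \<theta>_periods T_funpow)

lemma \<psi>_joint_continuous: "continuous_on ({0..} \<times> UNIV \<times> UNIV) (\<lambda>(t, q, v). \<psi> t q v)"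
  using cocycle by (simp add: cocycle_def)

lemma continuous_time: "continuous_on {0..} (\<lambda>t. \<psi> t p v)"
proof -
  have 1: "continuous_on {0..} (\<lambda>t. (t, p, v))" by (intro continuous_intros)
  have 2: "(\<lambda>t. (t, p, v)) ` {0..} \<subseteq> {0..} \<times> UNIV \<times> UNIV" by auto
  show ?thesis using continuous_on_compose2[OF \<psi>_joint_continuous 1 2] by simp
qed

lemma continuous_state:
  assumes "t \<ge> 0"
  shows "continuous_on UNIV (\<psi> t p)"
proof -
  have 1: "continuous_on UNIV (\<lambda>v. (t, p, v))" by (intro continuous_intros)
  have 2: "range (\<lambda>v. (t, p, v)) \<subseteq> {0..} \<times> UNIV \<times> UNIV" using assms by auto
  show ?thesis using continuous_on_compose2[OF \<psi>_joint_continuous 1 2] by simp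
qed

lemma continuous_rate: "continuous_on A (\<lambda>s. \<nu>0 (\<theta> s q))"
proof -
  have 1: "continuous_on UNIV (\<lambda>(t, q). \<theta> t q)"
    using flow by (simp add: minimal_periodic_flow_def)
  have 2: "continuous_on A (\<lambda>s. (s, q))" by (intro continuous_intros)
  have "continuous_on A (\<lambda>s. \<theta> s q)" using continuous_on_compose2[OF 1 2] by simp
  then show ?thesis by (rule continuous_on_compose2[OF continuous_\<nu>0]) simp
qed

lemma rate_bounds: "\<nu>m \<le> \<nu>0 p" "\<nu>0 p \<le> \<nu>p"
  using squeezing by (auto simp: squeezing_property_def)

lemma E_0: "E 0 = 0"
  by (simp add: E_def exponent_integral_def)

lemma E_bounds:
  assumes "0 \<le> s" "s \<le> r"
  shows "\<nu>m * (r - s) \<le> E r - E s" "E r - E s \<le> \<nu>p * (r - s)"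
proof -
  have int: "(\<lambda>s. \<nu>0 (\<theta> s q)) integrable_on {a..b}" for a b
    using integrable_continuous_real[OF continuous_rate] .
  have E: "E r - E s = integral {s..r} (\<lambda>s. \<nu>0 (\<theta> s q))"
    unfolding E_def exponent_integral_def
    using Henstock_Kurzweil_Integration.integral_combine[OF assms int] by simp
  have "integral {s..r} (\<lambda>_. \<nu>m) \<le> E r - E s" "E r - E s \<le> integral {s..r} (\<lambda>_. \<nu>p)"
    unfolding E by (rule integral_le; use rate_bounds int in \<open>simp add: integrable_const_ivl\<close>)+
  then show "\<nu>m * (r - s) \<le> E r - E s" "E r - E s \<le> \<nu>p * (r - s)"
    using assms by (simp_all add: algebra_simps)
qed

lemma continuous_E: "continuous_on {0..r} E"
  unfolding E_def exponent_integral_def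
  using indefinite_integral_continuous_1[OF integrable_continuous_real[OF continuous_rate]] .

lemma h_diff: "h (x - y) = h x - h y"
  using linear_h by (simp add: bounded_linear.linear linear_diff)

lemma continuous_h: "continuous_on A h"
  using linear_h by (rule linear_continuous_on)

lemma squeezing_from_zero:
  obtains \<delta> \<tau> where "\<delta> > 0" "\<tau> \<ge> 0"
    "\<forall>u v r. r \<ge> \<tau> \<longrightarrow> exp (2 * E r) * V (\<psi> r q u - \<psi> r q v) - V (u - v)
      \<le> - \<delta> * integral {0..r} (\<lambda>s. exp (2 * E s) * (norm (J (\<psi> s q u - \<psi> s q v)))\<^sup>2)"
proof -
  obtain \<delta> \<tau> where d: "\<delta> > 0" "\<tau> \<ge> 0" and sq: "\<forall>q v1 v2. \<forall>r\<ge>0. \<forall>l\<ge>0. r - l \<ge> \<tau> \<longrightarrow>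
        exp (2 * exponent_integral \<theta> \<nu>0 r q) * V (\<psi> r q v1 - \<psi> r q v2)
        - exp (2 * exponent_integral \<theta> \<nu>0 l q) * V (\<psi> l q v1 - \<psi> l q v2)
        \<le> - \<delta> * integral {l..r}
              (\<lambda>s. exp (2 * exponent_integral \<theta> \<nu>0 s q) * (norm (J (\<psi> s q v1 - \<psi> s q v2)))\<^sup>2)"
    using squeezing unfolding squeezing_property_def by blast
  show ?thesis
  proof (rule that[OF d], intro allI impI)
    fix u v r assume "r \<ge> \<tau>"
    then have r: "0 \<le> r" "r - 0 \<ge> \<tau>" using d(2) by auto
    show "exp (2 * E r) * V (\<psi> r q u - \<psi> r q v) - V (u - v)
      \<le> - \<delta> * integral {0..r} (\<lambda>s. exp (2 * E s) * (norm (J (\<psi> s q u - \<psi> s q v)))\<^sup>2)"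
      using sq[THEN spec, of q, THEN spec, of u, THEN spec, of v, rule_format, OF r(1) order_refl r(2)]
      unfolding E_def[symmetric] by (simp add: E_0 \<psi>_0)
  qed
qed

lemma continuous_gap: "continuous_on {0..} (\<lambda>s. (norm (J (\<psi> s q u - \<psi> s q v)))\<^sup>2)"
proof -
  have "continuous_on {0..} (\<lambda>s. \<psi> s q u - \<psi> s q v)"
    by (rule continuous_on_diff[OF continuous_time continuous_time])
  then have "continuous_on {0..} (\<lambda>s. J (\<psi> s q u - \<psi> s q v))"
    by (rule bounded_linear.continuous_on[OF blinfun.bounded_linear_right])
  then show ?thesis by (intro continuous_on_power continuous_on_norm)
qed

lemma lipschitz_on_interval:
  assumes "d > 0"
  obtains L where "L > 0"
    "\<And>p t u v. t \<in> {0..d} \<Longrightarrow> norm (\<psi> t p u - \<psi> t p v) \<le> L * norm (u - v)"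
proof -
  obtain \<tau> where "\<forall>d>0. \<exists>L>0. \<forall>p u v.
      (\<forall>t\<in>{\<tau>..\<tau> + d}. norm (\<psi> t p u - \<psi> t p v) \<le> L * norm (J (u - v))) \<and>
      (\<forall>t\<in>{0..d}. norm (\<psi> t p u - \<psi> t p v) \<le> L * norm (u - v))"
    using lipschitz unfolding uniform_lipschitz_property_def by auto
  then have "\<exists>L>0. \<forall>p u v.
      (\<forall>t\<in>{\<tau>..\<tau> + d}. norm (\<psi> t p u - \<psi> t p v) \<le> L * norm (J (u - v))) \<and>
      (\<forall>t\<in>{0..d}. norm (\<psi> t p u - \<psi> t p v) \<le> L * norm (u - v))"
    using assms by simp
  then obtain L where L: "L > 0" "\<forall>p u v.
      (\<forall>t\<in>{\<tau>..\<tau> + d}. norm (\<psi> t p u - \<psi> t p v) \<le> L * norm (J (u - v))) \<and>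
      (\<forall>t\<in>{0..d}. norm (\<psi> t p u - \<psi> t p v) \<le> L * norm (u - v))"
    by (elim exE conjE)
  show ?thesis by (rule that[OF L(1)]) (use L(2) in simp)
qed

lemma continuous_weighted_gap:
  "continuous_on {0..r} (\<lambda>s. exp (2 * E s) * (norm (J (\<psi> s q u - \<psi> s q v)))\<^sup>2)"
proof -
  have "continuous_on {0..r} (\<lambda>s. (norm (J (\<psi> s q u - \<psi> s q v)))\<^sup>2)"
    by (rule continuous_on_subset[OF continuous_gap]) auto
  then show ?thesis by (intro continuous_on_mult continuous_on_exp continuous_E continuous_on_const)
qed

text \<open>
  Start the two orbits at their points \<open>X (Suc j)\<close>, \<open>Y (Suc j)\<close>, that is \<open>Suc j\<close> periods in the past.
  After division by the weight at the final time, the initial value of \<open>V\<close> contributes at most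
  \<open>C\<close> times the \<open>Suc j\<close>-th power of a number below 1, while the dissipation over the last period before time \<open>0\<close>
  contributes at least a fixed \<open>\<delta> * K > 0\<close>. Let \<open>j\<close> tend to infinity.
\<close>

lemma ancient_separation:
  assumes x: "x \<in> ancient T" and y: "y \<in> ancient T" and ne: "x \<noteq> y" and t: "t \<ge> 0"
  shows "V (\<psi> t q x - \<psi> t q y) < 0"
proof -
  obtain X Y where X: "backward_orbit T X" "X 0 = x" and Y: "backward_orbit T Y" "Y 0 = y"
    using x y by (auto simp: ancient_def)
  obtain bx where bx: "\<And>j. norm (X j) \<le> bx"
    using X(1) unfolding backward_orbit_def bounded_iff by blast
  obtain b_y where b_y: "\<And>j. norm (Y j) \<le> b_y"
    using Y(1) unfolding backward_orbit_def bounded_iff by blast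
  obtain M where M: "\<And>v. V v \<le> M * (norm v)\<^sup>2" using V_growth by blast
  define C where "C = \<bar>M\<bar> * (bx + b_y)\<^sup>2"
  have VC: "V (X j - Y j) \<le> C" for j
  proof -
    have "norm (X j - Y j) \<le> bx + b_y"
      using norm_triangle_ineq4[of "X j" "Y j"] bx[of j] b_y[of j] by linarith
    then have "(norm (X j - Y j))\<^sup>2 \<le> (bx + b_y)\<^sup>2" by (simp add: power_mono)
    then have "\<bar>M\<bar> * (norm (X j - Y j))\<^sup>2 \<le> C" unfolding C_def by (simp add: mult_left_mono)
    moreover have "M * (norm (X j - Y j))\<^sup>2 \<le> \<bar>M\<bar> * (norm (X j - Y j))\<^sup>2"
      by (simp add: mult_right_mono)
    ultimately show ?thesis using M[of "X j - Y j"] by linarith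
  qed
  have rewind: "\<psi> (s + real j * \<sigma>) q (X (j + i)) = \<psi> s q (X i)"
    "\<psi> (s + real j * \<sigma>) q (Y (j + i)) = \<psi> s q (Y i)" if "s \<ge> 0" for s j i
    using that X(1) Y(1) by (simp_all add: \<psi>_shift_periods backward_orbit_funpow)
  \<comment> \<open>The dissipation over the last period before time \<open>0\<close>, without its weight; it does not depend on \<open>j\<close>.\<close>
  define g where "g s = (norm (J (\<psi> s q (X 1) - \<psi> s q (Y 1))))\<^sup>2" for s
  have gc: "continuous_on {0..\<sigma>} g"
    unfolding g_def using continuous_on_subset[OF continuous_gap] by force
  have "\<psi> \<sigma> q (X 1) = x" "\<psi> \<sigma> q (Y 1) = y"
    using X Y unfolding backward_orbit_def T_def by auto
  then have "g \<sigma> \<noteq> 0" using ne inj_J by (auto simp: g_def blinfun.diff_right dest: injD)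
  then have "integral {0..\<sigma>} g \<noteq> 0"
    using integral_eq_0_iff[OF gc period_pos] period_pos by (auto simp: g_def)
  moreover have "integral {0..\<sigma>} g \<ge> 0"
    by (rule integral_nonneg[OF integrable_continuous_real[OF gc]]) (simp add: g_def)
  ultimately have I: "integral {0..\<sigma>} g > 0" by simp
  \<comment> \<open>The rate is at most \<open>\<nu>p\<close>, so over a time of at most \<open>t + \<sigma>\<close> the weight grows by at most the factor \<open>exp (2 * \<nu>p * (t + \<sigma>))\<close>.\<close>
  define K where "K = exp (- 2 * \<nu>p * (t + \<sigma>)) * integral {0..\<sigma>} g"
  have K: "K > 0" using I by (simp add: K_def)
  have nup: "\<nu>p > 0" using rate_pos rate_bounds[of q] by linarith
  obtain \<delta> \<tau> where d: "\<delta> > 0" "\<tau> \<ge> 0"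
    and sq: "\<forall>u v r. r \<ge> \<tau> \<longrightarrow> exp (2 * E r) * V (\<psi> r q u - \<psi> r q v) - V (u - v)
      \<le> - \<delta> * integral {0..r} (\<lambda>s. exp (2 * E s) * (norm (J (\<psi> s q u - \<psi> s q v)))\<^sup>2)"
    using squeezing_from_zero .
  have key: "V (\<psi> t q x - \<psi> t q y) \<le> exp (- (2 * \<nu>m * \<sigma>)) ^ Suc j * C - \<delta> * K"
    if j: "real (Suc j) * \<sigma> \<ge> \<tau>" for j
  proof -
    define r where "r = t + real (Suc j) * \<sigma>"
    define u v where "u = X (Suc j)" and "v = Y (Suc j)"
    define G where "G = (\<lambda>s. exp (2 * E s) * (norm (J (\<psi> s q u - \<psi> s q v)))\<^sup>2)"
    have r: "r \<ge> 0" "r \<ge> \<tau>" "real j * \<sigma> \<ge> 0" "(real j + 1) * \<sigma> \<le> r"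
      using t period_pos j by (auto simp: r_def algebra_simps)
    have Gc: "continuous_on {0..r} G"
      unfolding G_def by (rule continuous_weighted_gap)
    have Gint: "G integrable_on {a..b}" if "0 \<le> a" "b \<le> r" for a b
      using integrable_continuous_real[OF continuous_on_subset[OF Gc]] that by auto
    have end_r: "\<psi> r q u = \<psi> t q x" "\<psi> r q v = \<psi> t q y"
      using rewind[OF t, of "Suc j" 0] X(2) Y(2) by (simp_all add: r_def u_def v_def)
    have "exp (2 * E r) * K = integral {0..\<sigma>} (\<lambda>s. exp (2 * E r - 2 * \<nu>p * (t + \<sigma>)) * g s)"
    proof -
      have "exp (2 * E r - 2 * \<nu>p * (t + \<sigma>)) = exp (2 * E r) * exp (- 2 * \<nu>p * (t + \<sigma>))"
        unfolding exp_add[symmetric] by simp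
      then show ?thesis by (simp only: K_def integral_mult_right mult.assoc)
    qed
    also have "\<dots> \<le> integral {0..\<sigma>} (\<lambda>s. G (s + real j * \<sigma>))"
    proof (rule integral_le)
      show "(\<lambda>s. exp (2 * E r - 2 * \<nu>p * (t + \<sigma>)) * g s) integrable_on {0..\<sigma>}"
        by (intro integrable_continuous_real continuous_intros gc)
      show "(\<lambda>s. G (s + real j * \<sigma>)) integrable_on {0..\<sigma>}"
        by (intro integrable_continuous_real continuous_on_compose2[OF Gc])
           (use r in \<open>auto intro!: continuous_intros simp: algebra_simps\<close>)
      fix s assume s: "s \<in> {0..\<sigma>}"
      let ?s = "s + real j * \<sigma>"
      have s': "0 \<le> ?s" "?s \<le> r" using s r by (auto simp: algebra_simps)
      have "r - ?s \<le> t + \<sigma>" using s by (simp add: r_def algebra_simps)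
      then have "\<nu>p * (r - ?s) \<le> \<nu>p * (t + \<sigma>)" using nup by simp
      then have "2 * E r - 2 * \<nu>p * (t + \<sigma>) \<le> 2 * E ?s"
        using E_bounds(2)[OF s'] by linarith
      moreover have "g s = (norm (J (\<psi> ?s q u - \<psi> ?s q v)))\<^sup>2"
        using rewind[of s j 1] s by (simp add: g_def u_def v_def)
      ultimately show "exp (2 * E r - 2 * \<nu>p * (t + \<sigma>)) * g s \<le> G ?s"
        unfolding G_def by (simp add: mult_right_mono)
    qed
    also have "\<dots> = integral {real j * \<sigma>..(real j + 1) * \<sigma>} G"
      using integral_shift_real_ivl[of "real j * \<sigma>" "real j * \<sigma>" "(real j + 1) * \<sigma>" G]
      by (simp add: algebra_simps)
    also have "\<dots> \<le> integral {0..r} G"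
      using r by (intro integral_subset_le Gint) (auto simp: G_def)
    finally have int: "exp (2 * E r) * K \<le> integral {0..r} G" .
    have "exp (2 * E r) * V (\<psi> t q x - \<psi> t q y) \<le> V (u - v) - \<delta> * integral {0..r} G"
      using sq[rule_format, OF r(2), of u v] by (simp add: end_r G_def)
    also have "\<dots> \<le> C - \<delta> * (exp (2 * E r) * K)"
      using VC[of "Suc j"] mult_left_mono[OF int less_imp_le[OF d(1)]] unfolding u_def v_def by linarith
    finally have "exp (2 * E r) * (V (\<psi> t q x - \<psi> t q y) + \<delta> * K) \<le> C"
      by (simp add: algebra_simps)
    then have 1: "V (\<psi> t q x - \<psi> t q y) + \<delta> * K \<le> exp (- (2 * E r)) * C"
      by (simp add: exp_minus field_simps)
    have "\<nu>m * (real (Suc j) * \<sigma>) \<le> \<nu>m * r" using rate_pos t by (simp add: r_def)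
    then have "\<nu>m * (real (Suc j) * \<sigma>) \<le> E r" using E_bounds(1)[of 0 r] r by (simp add: E_0)
    then have "exp (- (2 * E r)) \<le> exp (real (Suc j) * (- (2 * \<nu>m * \<sigma>)))"
      by (simp add: algebra_simps)
    also have "\<dots> = exp (- (2 * \<nu>m * \<sigma>)) ^ Suc j" by (rule exp_of_nat_mult)
    finally have "exp (- (2 * E r)) * C \<le> exp (- (2 * \<nu>m * \<sigma>)) ^ Suc j * C"
      by (intro mult_right_mono) (simp_all add: C_def)
    then show ?thesis using 1 by linarith
  qed
  have "(\<lambda>j. exp (- (2 * \<nu>m * \<sigma>)) ^ Suc j * C) \<longlonglongrightarrow> 0"
    using rate_pos period_pos
    by (intro tendsto_mult_left_zero LIMSEQ_Suc LIMSEQ_realpow_zero) auto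
  then have "\<forall>\<^sub>F j in sequentially. exp (- (2 * \<nu>m * \<sigma>)) ^ Suc j * C < \<delta> * K"
    by (rule order_tendstoD(2)) (simp add: K d(1))
  moreover have "\<forall>\<^sub>F j in sequentially. real (Suc j) * \<sigma> \<ge> \<tau>"
  proof -
    obtain N where N: "\<tau> / \<sigma> \<le> real N" using real_arch_simple by blast
    have "\<tau> \<le> real (Suc j) * \<sigma>" if "j \<ge> N" for j
    proof -
      have "\<tau> / \<sigma> \<le> real (Suc j)" using N that by simp
      then show ?thesis using period_pos by (simp only: pos_divide_le_eq)
    qed
    then show ?thesis by (rule eventually_sequentiallyI)
  qed
  ultimately have "\<forall>\<^sub>F j in sequentially. V (\<psi> t q x - \<psi> t q y) < 0"
    by eventually_elim (use key in fastforce)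
  then show ?thesis by simp
qed

text \<open>
  If the heights of two trajectories never agree, the intermediate value theorem fixes their order.
\<close>

lemma order_kept:
  fixes k :: "'a \<Rightarrow> real"
  assumes k: "continuous_on UNIV k" and start: "k x < k y"
    and ne: "\<And>t. t \<ge> 0 \<Longrightarrow> k (\<psi> t q x) \<noteq> k (\<psi> t q y)" and t: "t \<ge> 0"
  shows "k (\<psi> t q x) < k (\<psi> t q y)"
proof (rule ccontr)
  assume "\<not> ?thesis"
  then have ge: "k (\<psi> t q x) - k (\<psi> t q y) \<ge> 0" by simp
  have "continuous_on {0..t} (\<lambda>s. k (\<psi> s q x) - k (\<psi> s q y))"
    by (intro continuous_on_diff continuous_on_compose2[OF k] continuous_on_subset[OF continuous_time]) auto
  then obtain s where "s \<ge> 0" "k (\<psi> s q x) - k (\<psi> s q y) = 0"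
    using IVT'[of "\<lambda>s. k (\<psi> s q x) - k (\<psi> s q y)" 0 0 t] ge start t by (auto simp: \<psi>_0)
  then show False using ne[of s] by simp
qed

lemma ancient_separation_h:
  assumes "x \<in> ancient T" "y \<in> ancient T" "x \<noteq> y" "t \<ge> 0"
  shows "h (\<psi> t q x) \<noteq> h (\<psi> t q y)"
proof
  assume "h (\<psi> t q x) = h (\<psi> t q y)"
  then have "0 \<le> V (\<psi> t q x - \<psi> t q y)" by (intro kernel_h) (simp add: h_diff)
  then show False using ancient_separation[OF assms] by linarith
qed

text \<open>
  For times up to the delay \<open>\<tau>\<close> of the squeezing property, the trajectory of \<open>u\<close> stays so close to that of \<open>p\<close>
  that it remains below that of \<open>f\<close>. From \<open>\<tau>\<close> on, squeezing keeps \<open>V\<close> negative on the difference to the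
  trajectory of \<open>f\<close>, so the two heights never meet. The statement is made for any suitable functional \<open>k\<close>
  because it is applied to both \<open>h\<close> and \<open>- h\<close>.
\<close>

lemma barrier_persists:
  fixes k :: "'a \<Rightarrow> real"
  assumes k: "bounded_linear k" "\<And>v. k v = 0 \<Longrightarrow> 0 \<le> V v"
    and p: "T p = p" and f: "T f = f" and less: "k p < k f"
  shows "\<exists>\<delta>>0. \<forall>u. dist u p < \<delta> \<longrightarrow> (\<forall>n. k ((T ^^ n) u) < k f)"
proof -
  have kc: "continuous_on UNIV k" using linear_continuous_on[OF k(1)] .
  have k_diff: "k (a - b) = k a - k b" for a b using k(1) by (simp add: bounded_linear.linear linear_diff)
  have V_neg: "V (\<psi> t q p - \<psi> t q f) < 0" if "t \<ge> 0" for t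
    using ancient_separation fixed_ancient p f less that by (metis less_irrefl)
  have kpf: "k (\<psi> t q p) < k (\<psi> t q f)" if "t \<ge> 0" for t
    using order_kept[OF kc less _ that] V_neg k(2) k_diff by (metis diff_self not_le)
  obtain \<delta>0 \<tau> where d0: "\<delta>0 > 0" "\<tau> \<ge> 0"
    and sq: "\<forall>u v r. r \<ge> \<tau> \<longrightarrow> exp (2 * E r) * V (\<psi> r q u - \<psi> r q v) - V (u - v)
      \<le> - \<delta>0 * integral {0..r} (\<lambda>s. exp (2 * E s) * (norm (J (\<psi> s q u - \<psi> s q v)))\<^sup>2)"
    using squeezing_from_zero .
  have kept: "V (\<psi> r q u - \<psi> r q v) < 0" if r: "r \<ge> \<tau>" and V0: "V (u - v) < 0" for r u v
  proof -
    let ?G = "\<lambda>s. exp (2 * E s) * (norm (J (\<psi> s q u - \<psi> s q v)))\<^sup>2"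
    have "?G integrable_on {0..r}"
      by (rule integrable_continuous_real[OF continuous_weighted_gap])
    then have "0 \<le> integral {0..r} ?G" by (rule integral_nonneg) simp
    then have "\<delta>0 * integral {0..r} ?G \<ge> 0" using d0 by simp
    then have "exp (2 * E r) * V (\<psi> r q u - \<psi> r q v) < 0" using sq[rule_format, OF r, of u v] V0 by linarith
    then show ?thesis by (simp add: mult_less_0_iff)
  qed
  have "continuous_on {0..\<tau>} (\<lambda>t. k (\<psi> t q f) - k (\<psi> t q p))"
    by (intro continuous_on_diff continuous_on_compose2[OF kc] continuous_on_subset[OF continuous_time]) auto
  then obtain t0 where t0: "t0 \<in> {0..\<tau>}"
    "\<And>t. t \<in> {0..\<tau>} \<Longrightarrow> k (\<psi> t0 q f) - k (\<psi> t0 q p) \<le> k (\<psi> t q f) - k (\<psi> t q p)"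
    using continuous_attains_inf[of "{0..\<tau>}"] d0(2) by fastforce
  define c where "c = k (\<psi> t0 q f) - k (\<psi> t0 q p)"
  have c: "c > 0" using kpf[of t0] t0(1) by (simp add: c_def)
  have "\<tau> + 1 > 0" using d0(2) by simp
  from lipschitz_on_interval[OF this] obtain L where L: "L > 0"
    "\<And>p t u v. t \<in> {0..\<tau> + 1} \<Longrightarrow> norm (\<psi> t p u - \<psi> t p v) \<le> L * norm (u - v)" by metis
  obtain H where H: "H > 0" "\<And>v. \<bar>k v\<bar> \<le> norm v * H"
    using bounded_linear.pos_bounded[OF k(1)] by auto
  have "open {u. V (u - f) < 0}"
    by (intro open_Collect_less continuous_on_compose2[OF continuous_V] continuous_intros) auto
  moreover have "V (p - f) < 0" using V_neg[of 0] by (simp add: \<psi>_0)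
  ultimately obtain \<delta>1 where d1: "\<delta>1 > 0" "\<And>u. dist u p < \<delta>1 \<Longrightarrow> V (u - f) < 0"
    unfolding open_dist by blast
  \<comment> \<open>Within this distance the height moves by less than the gap \<open>c\<close> up to time \<open>\<tau>\<close>.\<close>
  define \<delta> where "\<delta> = min \<delta>1 (c / (L * H))"
  have early: "k (\<psi> t q u) < k (\<psi> t q f)" if u: "dist u p < \<delta>" and t: "t \<in> {0..\<tau>}" for u t
  proof -
    have "\<bar>k (\<psi> t q u - \<psi> t q p)\<bar> \<le> norm (\<psi> t q u - \<psi> t q p) * H" by (rule H(2))
    also have "\<dots> \<le> L * norm (u - p) * H" using L(2)[of t q u p] t H(1) by simp
    also have "\<dots> < c"
      using u L(1) H(1) by (simp add: \<delta>_def dist_norm pos_less_divide_eq algebra_simps)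
    also have "c \<le> k (\<psi> t q f) - k (\<psi> t q p)" using t0(2)[OF t] by (simp add: c_def)
    finally show ?thesis by (simp add: k_diff)
  qed
  have late: "k (\<psi> t q u) < k (\<psi> t q f)" if u: "dist u p < \<delta>" and t: "t \<ge> 0" for u t
  proof (rule order_kept[OF kc _ _ t])
    show "k u < k f" using early[OF u, of 0] d0(2) by (simp add: \<psi>_0)
    fix s :: real assume s: "s \<ge> 0"
    show "k (\<psi> s q u) \<noteq> k (\<psi> s q f)"
    proof (cases "s \<le> \<tau>")
      case True
      then show ?thesis using early[OF u, of s] s by simp
    next
      case False
      then have "V (\<psi> s q u - \<psi> s q f) < 0" using kept d1(2) u by (simp add: \<delta>_def)
      then show ?thesis using k(2)[of "\<psi> s q u - \<psi> s q f"] by (auto simp: k_diff)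
    qed
  qed
  have ff: "\<psi> (real n * \<sigma>) q f = f" for n
    using fixed_funpow[of T f n] f by (simp add: T_funpow)
  have "\<delta> > 0" using d1(1) c L(1) H(1) by (simp add: \<delta>_def)
  have "k ((T ^^ n) u) < k f" if "dist u p < \<delta>" for u n
    using late[OF that, of "real n * \<sigma>"] period_pos by (simp add: ff T_funpow)
  then show ?thesis using \<open>\<delta> > 0\<close> by blast
qed

text \<open>
  Up to finitely many terms the sequence lies in \<open>(T ^^ N) ` B\<close>, whose measure of noncompactness becomes
  arbitrarily small as \<open>N\<close> grows.
\<close>

lemma T_asymptotically_compact:
  assumes B: "bounded B" and n: "filterlim n at_top sequentially"
    and u: "\<forall>k. \<forall>j\<le>n k. (T ^^ j) (u k) \<in> B"
  shows "\<exists>r l. strict_mono (r :: nat \<Rightarrow> nat) \<and> (\<lambda>k. (T ^^ n (r k)) (u (r k))) \<longlonglongrightarrow> l"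
proof (rule convergent_subseq_of_totally_bounded)
  fix e :: real assume e: "e > 0"
  have "\<exists>\<gamma>0 :: real \<Rightarrow> real. (\<forall>t\<ge>0. 0 \<le> \<gamma>0 t) \<and> (\<gamma>0 \<longlongrightarrow> 0) at_top \<and>
      (\<forall>t\<ge>0. \<forall>B. bounded B \<longrightarrow> kuratowski_measure {\<psi> t q' v | q' v. q' \<in> {q} \<and> v \<in> B}
        \<le> ennreal (\<gamma>0 t * exp (- \<nu>p * t)) * kuratowski_measure B)"
    using compactness[unfolded asymptotically_compact_def, THEN spec, of "{q}"] by simp
  then obtain \<gamma>0 where g: "\<forall>t\<ge>0. 0 \<le> \<gamma>0 t" "(\<gamma>0 \<longlongrightarrow> 0) at_top"
    and kur: "\<forall>t\<ge>0. \<forall>B. bounded B \<longrightarrow> kuratowski_measure {\<psi> t q' v | q' v. q' \<in> {q} \<and> v \<in> B}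
      \<le> ennreal (\<gamma>0 t * exp (- \<nu>p * t)) * kuratowski_measure B"
    by (elim exE conjE)
  define d where "d = diameter B"
  have d: "d \<ge> 0" using diameter_ge_0[OF B] by (simp add: d_def)
  have nup: "\<nu>p \<ge> 0" using rate_pos rate_bounds[of q] by linarith
  have "filterlim (\<lambda>N. real N * \<sigma>) at_top sequentially"
    by (rule filterlim_at_top_mult_tendsto_pos[OF tendsto_const period_pos filterlim_real_sequentially])
  then have \<gamma>0_lim: "(\<lambda>N. \<gamma>0 (real N * \<sigma>) * d) \<longlonglongrightarrow> 0"
    using filterlim_compose[OF g(2)] tendsto_mult_left_zero by blast
  then obtain N where N: "\<gamma>0 (real N * \<sigma>) * d < e"
    using eventually_happens'[OF sequentially_bot order_tendstoD(2)[OF \<gamma>0_lim e]] by auto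
  let ?t = "real N * \<sigma>"
  have t: "?t \<ge> 0" using period_pos by simp
  have img: "(T ^^ N) ` B = {\<psi> ?t q' v | q' v. q' \<in> {q} \<and> v \<in> B}" by (auto simp: T_funpow)
  have "kuratowski_measure ((T ^^ N) ` B) \<le> ennreal (\<gamma>0 ?t * exp (- \<nu>p * ?t)) * ennreal d"
    unfolding img d_def
    by (rule order_trans[OF kur[rule_format, OF t B] mult_left_mono])
       (simp_all add: kuratowski_measure_le_diameter[OF B])
  also have "\<dots> = ennreal (\<gamma>0 ?t * exp (- \<nu>p * ?t) * d)"
    using g(1) t d by (simp add: ennreal_mult)
  also have "\<dots> \<le> ennreal (\<gamma>0 ?t * d)"
  proof (rule ennreal_leI)
    have "exp (- \<nu>p * ?t) \<le> 1" using nup t by simp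
    then have "\<gamma>0 ?t * exp (- \<nu>p * ?t) \<le> \<gamma>0 ?t" using g(1) t by (intro mult_left_le) auto
    then show "\<gamma>0 ?t * exp (- \<nu>p * ?t) * d \<le> \<gamma>0 ?t * d" using d by (rule mult_right_mono)
  qed
  also have "\<dots> < ennreal e" using N g(1) t d by (intro ennreal_lessI e)
  finally obtain F where F: "finite F" "(T ^^ N) ` B \<subseteq> (\<Union>a\<in>F. cball a e)"
    by (rule kuratowski_measure_less_cover)
  let ?x = "\<lambda>k. (T ^^ n k) (u k)"
  have "\<forall>\<^sub>F k in sequentially. N \<le> n k" using n by (simp add: filterlim_at_top)
  then obtain k0 where k0: "\<And>k. k \<ge> k0 \<Longrightarrow> N \<le> n k" by (auto simp: eventually_sequentially)
  have "?x k \<in> (\<Union>a\<in>F \<union> ?x ` {..<k0}. cball a e)" for k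
  proof (cases "k < k0")
    case False
    then have "N \<le> n k" using k0 by simp
    then have "?x k = (T ^^ N) ((T ^^ (n k - N)) (u k))"
      using fun_cong[OF funpow_add[of N "n k - N" T]] by simp
    moreover have "(T ^^ (n k - N)) (u k) \<in> B" using u by simp
    ultimately have "?x k \<in> (T ^^ N) ` B" by simp
    then show ?thesis using subsetD[OF F(2)] by blast
  qed (use e in force)
  then have "range ?x \<subseteq> (\<Union>a\<in>F \<union> ?x ` {..<k0}. cball a e)" by blast
  then show "\<exists>F. finite F \<and> range ?x \<subseteq> (\<Union>a\<in>F. cball a e)"
    using F(1) by (intro exI[of _ "F \<union> ?x ` {..<k0}"]) auto
qed

lemma stable_fixed_point_T:
  obtains p where "T p = p" "\<forall>\<epsilon>>0. \<exists>\<delta>>0. \<forall>u. dist u p < \<delta> \<longrightarrow> (\<forall>n. dist ((T ^^ n) u) p < \<epsilon>)"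
proof -
  have S: "S \<noteq> {}" "closed S" "bounded S"
    and "\<exists>U. open U \<and> S \<subseteq> U \<and> (\<forall>v\<in>U. \<forall>q. \<exists>t0\<ge>0. \<forall>t\<ge>t0. \<psi> t q v \<in> S)"
    using sink unfolding sink_def by simp_all
  then obtain U where U: "open U" "S \<subseteq> U"
    and attr: "\<forall>v\<in>U. \<forall>q. \<exists>t0\<ge>0. \<forall>t\<ge>t0. \<psi> t q v \<in> S"
    by (elim exE conjE)
  have attracted: "\<exists>n0. \<forall>n\<ge>n0. (T ^^ n) v \<in> S" if v: "v \<in> U" for v
  proof -
    obtain t0 where t0: "\<forall>t\<ge>t0. \<psi> t q v \<in> S"
      using attr[THEN bspec, OF v, THEN spec, of q] by (elim exE conjE)
    obtain n0 where n0: "t0 / \<sigma> \<le> real n0" using real_arch_simple by blast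
    have "t0 \<le> real n * \<sigma>" if "n \<ge> n0" for n
    proof -
      have "t0 / \<sigma> \<le> real n" using n0 that by simp
      then show ?thesis using period_pos by (simp only: pos_divide_le_eq)
    qed
    then show ?thesis using t0 by (auto simp: T_funpow)
  qed
  interpret monotone_on_ancient T h S U
  proof
    show "continuous_on UNIV T" using continuous_state period_pos by (simp add: T_def)
    show "continuous_on UNIV h" by (rule continuous_h)
    show "bounded (h ` B)" if "bounded B" for B using bounded_linear_image[OF that linear_h] .
    show "inj_on h (ancient T)"
      using ancient_separation_h[of _ _ 0] by (auto simp: inj_on_def \<psi>_0)
    show "h (T x) < h (T y)" if "x \<in> ancient T" "y \<in> ancient T" "h x < h y" for x y
      unfolding T_def using that period_pos
      by (intro order_kept continuous_h ancient_separation_h) auto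
    show "\<exists>r l. strict_mono (r :: nat \<Rightarrow> nat) \<and> (\<lambda>k. (T ^^ n (r k)) (u (r k))) \<longlonglongrightarrow> l"
      if "bounded B" "filterlim n at_top sequentially" "\<forall>k. \<forall>j\<le>n k. (T ^^ j) (u k) \<in> B" for B n u
      using T_asymptotically_compact[OF that] .
    show "\<exists>\<delta>>0. \<forall>u. dist u p < \<delta> \<longrightarrow> (\<forall>n. h ((T ^^ n) u) < h f)"
      if "T p = p" "T f = f" "h p < h f" for p f
      using barrier_persists[OF linear_h kernel_h that] .
    show "\<exists>\<delta>>0. \<forall>u. dist u p < \<delta> \<longrightarrow> (\<forall>n. h f < h ((T ^^ n) u))"
      if "T p = p" "T f = f" "h f < h p" for p f
      using barrier_persists[OF bounded_linear_minus[OF linear_h] _ that(1,2)] kernel_h that(3) by simp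
    show "\<exists>n0. \<forall>n\<ge>n0. (T ^^ n) v \<in> S" if "v \<in> U" for v using attracted[OF that] .
  qed (use S U in auto)
  show ?thesis using stable_fixed_point that .
qed

section \<open>Periodic trajectories from fixed points\<close>

definition periodic_extension :: "'a \<Rightarrow> real \<Rightarrow> 'a" where
  "periodic_extension p t = \<psi> (t - of_int \<lfloor>t / \<sigma>\<rfloor> * \<sigma>) q p"

context
  fixes p assumes fixed: "T p = p"
begin

text \<open>
  Any number of whole periods can be added to reach a nonnegative time. This reduces the extension
  to the semiflow near any given, possibly negative, time.
\<close>

lemma periodic_extension_eq:
  assumes t: "t + real n * \<sigma> \<ge> 0"
  shows "periodic_extension p t = \<psi> (t + real n * \<sigma>) q p"
proof -
  have "\<lfloor>t / \<sigma>\<rfloor> + int n \<ge> 0"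
  proof -
    have "t / \<sigma> + real n \<ge> 0" using t period_pos by (simp add: field_simps)
    then show ?thesis using zero_le_floor[of "t / \<sigma> + real n"] by simp
  qed
  then obtain m where m: "\<lfloor>t / \<sigma>\<rfloor> + int n = int m" using nonneg_int_cases by blast
  define \<rho> where "\<rho> = t - of_int \<lfloor>t / \<sigma>\<rfloor> * \<sigma>"
  have "of_int \<lfloor>t / \<sigma>\<rfloor> * \<sigma> \<le> t"
    using of_int_floor_le[of "t / \<sigma>"] by (simp only: pos_le_divide_eq[OF period_pos])
  then have "\<rho> \<ge> 0" by (simp add: \<rho>_def)
  have m': "real m = of_int \<lfloor>t / \<sigma>\<rfloor> + real n" using m by linarith
  have "t + real n * \<sigma> = \<rho> + real m * \<sigma>"
    unfolding m' \<rho>_def by (simp add: algebra_simps)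
  then have "\<psi> (t + real n * \<sigma>) q p = \<psi> \<rho> q ((T ^^ m) p)"
    using \<psi>_shift_periods[OF \<open>\<rho> \<ge> 0\<close>] by simp
  then show ?thesis using fixed_funpow[of T p m] fixed by (simp add: periodic_extension_def \<rho>_def)
qed

lemma exists_period_shift:
  obtains n where "t + real n * \<sigma> > 0"
proof -
  obtain n where "- t / \<sigma> < real n" using reals_Archimedean2 by blast
  then have "- t < real n * \<sigma>" using pos_divide_less_eq[OF period_pos] by blast
  then show ?thesis using that[of n] by linarith
qed

lemma periodic_extension_trajectory: "complete_trajectory \<theta> \<psi> q (periodic_extension p)"
  unfolding complete_trajectory_def
proof (intro conjI allI impI)
  have "isCont (periodic_extension p) t" for t
  proof -
    obtain n where n: "t + real n * \<sigma> > 0" using exists_period_shift .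
    have "continuous_on {- real n * \<sigma><..} (\<lambda>s. \<psi> (s + real n * \<sigma>) q p)"
      by (intro continuous_on_compose2[OF continuous_time] continuous_intros) auto
    then have "continuous_on {- real n * \<sigma><..} (periodic_extension p)"
      by (rule continuous_on_eq) (auto simp: periodic_extension_eq[of _ n])
    then show ?thesis using n by (auto simp: continuous_on_eq_continuous_at)
  qed
  then show "continuous_on UNIV (periodic_extension p)" by (simp add: continuous_on_eq_continuous_at)
  fix s t :: real assume t: "t \<ge> 0"
  obtain n where n: "s + real n * \<sigma> > 0" using exists_period_shift .
  have "periodic_extension p (t + s) = \<psi> (t + (s + real n * \<sigma>)) q p"
    using n t by (subst periodic_extension_eq[of _ n]) (auto simp: algebra_simps)
  also have "\<dots> = \<psi> t (\<theta> (s + real n * \<sigma>) q) (\<psi> (s + real n * \<sigma>) q p)"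
    using n t by (intro \<psi>_add) auto
  also have "\<dots> = \<psi> t (\<theta> s q) (periodic_extension p s)"
    using n by (simp add: \<theta>_shift_periods periodic_extension_eq[of s n])
  finally show "periodic_extension p (t + s) = \<psi> t (\<theta> s q) (periodic_extension p s)" .
qed

lemma periodic_extension_periodic: "periodic_with \<sigma> (periodic_extension p)"
proof -
  have "(t + \<sigma>) / \<sigma> = t / \<sigma> + 1" for t using period_pos by (simp add: field_simps)
  then show ?thesis by (simp add: periodic_with_def periodic_extension_def algebra_simps)
qed

text \<open>
  From time \<open>s\<close>, at most one period leads to the next multiple of \<open>\<sigma>\<close>, where the trajectory passes
  through \<open>p\<close>. There the stability of \<open>p\<close> under \<open>T\<close> takes over, and between two multiples of \<open>\<sigma>\<close> deviations grow
  at most by the Lipschitz constant of one period.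
\<close>

lemma periodic_extension_stable:
  assumes stable: "\<forall>\<epsilon>>0. \<exists>\<delta>>0. \<forall>u. dist u p < \<delta> \<longrightarrow> (\<forall>n. dist ((T ^^ n) u) p < \<epsilon>)"
  shows "lyapunov_stable \<theta> \<psi> q (periodic_extension p)"
  unfolding lyapunov_stable_def
proof (intro allI impI)
  let ?w = "periodic_extension p"
  have traj: "?w (t + s) = \<psi> t (\<theta> s q) (?w s)" if "t \<ge> 0" for t s
    using periodic_extension_trajectory that by (simp add: complete_trajectory_def)
  fix \<epsilon> s :: real assume e: "\<epsilon> > 0"
  obtain L where L: "L > 0"
    "\<And>q t v1 v2. t \<in> {0..\<sigma>} \<Longrightarrow> norm (\<psi> t q v1 - \<psi> t q v2) \<le> L * norm (v1 - v2)"
    using lipschitz_on_interval[OF period_pos] by metis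
  obtain \<delta>1 where d1: "\<delta>1 > 0" "\<And>u n. dist u p < \<delta>1 \<Longrightarrow> dist ((T ^^ n) u) p < \<epsilon> / L"
    using stable[rule_format, of "\<epsilon> / L"] e L(1) by auto
  \<comment> \<open>The time left until the next multiple of \<open>\<sigma>\<close>.\<close>
  define t0 where "t0 = of_int \<lceil>s / \<sigma>\<rceil> * \<sigma> - s"
  have "s / \<sigma> * \<sigma> \<le> of_int \<lceil>s / \<sigma>\<rceil> * \<sigma>" "of_int \<lceil>s / \<sigma>\<rceil> * \<sigma> \<le> (s / \<sigma> + 1) * \<sigma>"
    using period_pos ceiling_correct[of "s / \<sigma>"] by (auto intro!: mult_right_mono simp del: times_divide_eq_left)
  then have t0: "0 \<le> t0" "t0 \<le> \<sigma>" using period_pos by (simp_all add: t0_def distrib_right)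
  have w0: "?w (t0 + s) = p"
    using period_pos by (simp add: t0_def periodic_extension_def \<psi>_0)
  have \<theta>0: "\<theta> (t0 + s) q = q"
  proof -
    obtain n where n: "t0 + s + real n * \<sigma> > 0" using exists_period_shift .
    define i where "i = \<lceil>s / \<sigma>\<rceil> + int n"
    have i: "t0 + s + real n * \<sigma> = real_of_int i * \<sigma>" by (simp add: t0_def i_def algebra_simps)
    then have "0 < real_of_int i * \<sigma>" using n by simp
    then have "i > 0" using period_pos by (simp add: zero_less_mult_iff)
    then obtain m where "i = int m" using nonneg_int_cases[of i] by auto
    then have "t0 + s + real n * \<sigma> = real m * \<sigma>" using i by simp
    then show ?thesis using \<theta>_shift_periods[of "t0 + s" n q] \<theta>_periods by simp
  qed
  define \<delta> where "\<delta> = min (\<delta>1 / L) (\<epsilon> / L)"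
  have "norm (\<psi> t (\<theta> s q) v - ?w (t + s)) < \<epsilon>" if v: "norm (v - ?w s) < \<delta>" and t: "t \<ge> 0" for v t
  proof (cases "t \<le> t0")
    case True
    then have "norm (\<psi> t (\<theta> s q) v - ?w (t + s)) \<le> L * norm (v - ?w s)"
      using L(2)[of t "\<theta> s q" v "?w s"] t t0 traj by simp
    also have "\<dots> < \<epsilon>" using v L(1) by (simp add: \<delta>_def pos_less_divide_eq mult.commute)
    finally show ?thesis .
  next
    case False
    define u where "u = \<psi> t0 (\<theta> s q) v"
    have "norm (u - p) \<le> L * norm (v - ?w s)"
      using L(2)[of t0 "\<theta> s q" v "?w s"] t0 traj[of t0 s] w0 by (simp add: u_def)
    also have "\<dots> < \<delta>1" using v L(1) by (simp add: \<delta>_def pos_less_divide_eq mult.commute)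
    finally have u: "dist u p < \<delta>1" by (simp add: dist_norm)
    define n where "n = nat \<lfloor>(t - t0) / \<sigma>\<rfloor>"
    define \<rho> where "\<rho> = t - t0 - real n * \<sigma>"
    have "(t - t0) / \<sigma> \<ge> 0" using False period_pos by simp
    then have "real n \<le> (t - t0) / \<sigma>" "(t - t0) / \<sigma> < real n + 1" unfolding n_def by linarith+
    then have \<rho>: "0 \<le> \<rho>" "\<rho> \<le> \<sigma>" using period_pos by (simp_all add: \<rho>_def field_simps)
    have "\<psi> t (\<theta> s q) v = \<psi> ((t - t0) + t0) (\<theta> s q) v" by simp
    also have "\<dots> = \<psi> (t - t0) (\<theta> t0 (\<theta> s q)) u"
      unfolding u_def using False t0 by (intro \<psi>_add) auto
    also have "\<dots> = \<psi> (\<rho> + real n * \<sigma>) q u"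
      using \<theta>0 by (simp add: \<theta>_add \<rho>_def)
    also have "\<dots> = \<psi> \<rho> q ((T ^^ n) u)" by (rule \<psi>_shift_periods[OF \<rho>(1)])
    finally have 1: "\<psi> t (\<theta> s q) v = \<psi> \<rho> q ((T ^^ n) u)" .
    have "?w (t + s) = ?w ((t - t0) + (t0 + s))" by simp
    also have "\<dots> = \<psi> (\<rho> + real n * \<sigma>) q p"
      using traj[of "t - t0" "t0 + s"] False by (simp only: \<theta>0 w0) (simp add: \<rho>_def)
    also have "\<dots> = \<psi> \<rho> q p"
      using \<psi>_shift_periods[OF \<rho>(1)] fixed_funpow[of T p n] fixed by simp
    finally have "norm (\<psi> t (\<theta> s q) v - ?w (t + s)) \<le> L * norm ((T ^^ n) u - p)"
      using L(2)[of \<rho> q] \<rho> by (simp add: 1)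
    also have "\<dots> < \<epsilon>"
      using d1(2)[OF u, of n] L(1) by (simp add: dist_norm pos_less_divide_eq mult.commute)
    finally show ?thesis .
  qed
  moreover have "\<delta> > 0" using d1(1) e L(1) by (simp add: \<delta>_def)
  ultimately show "\<exists>\<delta>>0. \<forall>v0. norm (v0 - ?w s) < \<delta> \<longrightarrow>
      (\<forall>t\<ge>0. norm (\<psi> t (\<theta> s q) v0 - ?w (t + s)) < \<epsilon>)" by blast
qed

end

lemma stable_periodic_trajectory:
  "\<exists>w. complete_trajectory \<theta> \<psi> q w \<and> periodic_with \<sigma> w \<and> lyapunov_stable \<theta> \<psi> q w"
proof -
  obtain p where "T p = p" "\<forall>\<epsilon>>0. \<exists>\<delta>>0. \<forall>u. dist u p < \<delta> \<longrightarrow> (\<forall>n. dist ((T ^^ n) u) p < \<epsilon>)"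
    using stable_fixed_point_T .
  then show ?thesis
    using periodic_extension_trajectory periodic_extension_periodic periodic_extension_stable by blast
qed

end

section \<open>The height function of the splitting\<close>

lemma line_coordinate:
  fixes Em :: "'a::real_normed_vector set" and Pm :: "'a \<Rightarrow>\<^sub>L 'a"
  assumes dim: "dim Em = 1" and sub: "subspace Em" and range: "\<And>v. Pm v \<in> Em"
  obtains h :: "'a \<Rightarrow> real" where "bounded_linear h" "\<forall>v. h v = 0 \<longleftrightarrow> Pm v = 0"
proof -
  obtain B where B: "B \<subseteq> Em" "independent B" "Em \<subseteq> span B" "card B = 1"
    using basis_exists[of Em] dim by metis
  then obtain e where "B = {e}" using card_1_singletonE by blast
  then have e: "e \<noteq> 0" "Em \<subseteq> span {e}" using B by auto
  have "\<forall>v. \<exists>c. Pm v = c *\<^sub>R e" using range e(2) by (auto simp: span_singleton)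
  then obtain h where h: "\<And>v. Pm v = h v *\<^sub>R e" by metis
  have "bounded_linear h"
  proof (rule bounded_linear_intro)
    fix x y r
    have "(h (x + y) - (h x + h y)) *\<^sub>R e = 0"
      using h[of "x + y"] h[of x] h[of y] by (simp add: blinfun.add_right algebra_simps)
    then show "h (x + y) = h x + h y" using e(1) by simp
    have "(h (r *\<^sub>R x) - r * h x) *\<^sub>R e = 0"
      using h[of "r *\<^sub>R x"] h[of x] by (auto simp: blinfun.scaleR_right algebra_simps)
    then show "h (r *\<^sub>R x) = r *\<^sub>R h x" using e(1) by simp
    have "\<bar>h x\<bar> * norm e \<le> norm Pm * norm x"
      using norm_blinfun[of Pm x] h[of x] by simp
    then show "norm (h x) \<le> norm x * (norm Pm / norm e)"
      using e(1) by (simp add: pos_le_divide_eq mult.commute)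
  qed
  then show ?thesis by (rule that) (use h e(1) in simp)
qed

lemma to_complex_0: "to_complex (0 :: 'k::real_or_complex) = 0"
  using to_complex_add[of "0 :: 'k" 0] by simp

lemma quadratic_form_bound:
  fixes P :: "'a::real_normed_vector \<Rightarrow>\<^sub>L ('a \<Rightarrow>\<^sub>L 'k::real_or_complex)"
  shows "quadratic_form P v \<le> norm P * (norm v)\<^sup>2"
proof -
  have "quadratic_form P v \<le> cmod (to_complex (P v v))"
    by (simp add: quadratic_form_def pairing_def complex_Re_le_cmod)
  also have "\<dots> = norm (P v v)" by (rule norm_to_complex)
  also have "\<dots> \<le> norm (P v) * norm v" by (rule norm_blinfun)
  also have "\<dots> \<le> norm P * norm v * norm v" by (intro mult_right_mono norm_blinfun) simp
  finally show ?thesis by (simp add: power2_eq_square)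
qed

lemma continuous_quadratic_form:
  fixes P :: "'a::real_normed_vector \<Rightarrow>\<^sub>L ('a \<Rightarrow>\<^sub>L 'k::real_or_complex)"
  shows "continuous_on UNIV (quadratic_form P)"
proof -
  have "bounded_linear (to_complex :: 'k \<Rightarrow> complex)"
    by (rule bounded_linear_intro[where K = 1])
       (simp_all add: to_complex_add to_complex_scaleR norm_to_complex)
  then have "continuous_on UNIV (\<lambda>v. to_complex (P v v))"
    by (rule bounded_linear.continuous_on) (intro continuous_intros)
  then show ?thesis
    unfolding quadratic_form_def pairing_def by (intro continuous_intros)
qed

text \<open>
  The splitting consists of subspaces over the scalar field; the dimension, and hence the coordinate along
  the negative line, refers to real scalars.
\<close>

lemma splitting_projector:
  assumes smul: "normed_space_over smul" and split: "direct_sum_splitting smul Ep Em Pm"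
  shows "subspace Em" "Pm v \<in> Em" "Pm v = 0 \<Longrightarrow> v \<in> Ep"
proof -
  interpret vector_space smul using smul by (simp add: normed_space_over_def)
  have sub: "module.subspace smul Em" and real: "\<And>r v. smul (of_real r) v = r *\<^sub>R v"
    using smul split by (auto simp: normed_space_over_def direct_sum_splitting_def)
  show "Real_Vector_Spaces.subspace Em"
    unfolding real_vector.subspace_def
    using subspace_0[OF sub] subspace_add[OF sub] subspace_scale[OF sub] by (metis real)
  obtain x y where "x \<in> Ep" "y \<in> Em" "v = x + y" "Pm v = y"
    using split unfolding direct_sum_splitting_def by metis
  then show "Pm v \<in> Em" "Pm v = 0 \<Longrightarrow> v \<in> Ep" by auto
qed

theorem theorem5p2p2:
  fixes \<theta> :: "real \<Rightarrow> 'q::complete_space \<Rightarrow> 'q"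
    and \<psi> :: "real \<Rightarrow> 'q \<Rightarrow> 'a::banach \<Rightarrow> 'a"
    and smulE :: "'k::real_or_complex \<Rightarrow> 'a \<Rightarrow> 'a"
    and smulH :: "'k \<Rightarrow> 'h::{real_inner, complete_space} \<Rightarrow> 'h"
    and J :: "'a \<Rightarrow>\<^sub>L 'h"
    and P :: "'a \<Rightarrow>\<^sub>L ('a \<Rightarrow>\<^sub>L 'k)"
    and Ep Em S :: "'a set"
    and Pm :: "'a \<Rightarrow>\<^sub>L 'a"
    and \<nu>0 :: "'q \<Rightarrow> real"
    and \<sigma> \<nu>m \<nu>p :: real
  assumes "\<sigma> > 0"
    and "minimal_periodic_flow \<sigma> \<theta>"
    and "normed_space_over smulE"
    and "normed_space_over smulH"
    and "continuous_embedding smulE smulH J"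
    and "cocycle \<theta> \<psi>"
    and "operator_into_dual smulE P"
    and "symmetric_operator P"
    and "direct_sum_splitting smulE Ep Em Pm"
    and "dim Em = 1"
    and "\<forall>v\<in>Ep - {0}. quadratic_form P v > 0"
    and "\<forall>v\<in>Em - {0}. quadratic_form P v < 0"
    and "squeezing_property \<theta> \<psi> J (quadratic_form P) \<nu>m \<nu>p \<nu>0"
    and "continuous_on UNIV \<nu>0"
    and "\<nu>m > 0"
    and "asymptotically_compact \<nu>p \<psi>"
    and "uniform_lipschitz_property \<psi> J"
    and "continuous_dependence_property (\<lambda>q::'q. P) (\<lambda>q. Pm)"
    and "sink \<psi> S"
  shows "\<exists>q w. complete_trajectory \<theta> \<psi> q w \<and> periodic_with \<sigma> w \<and> lyapunov_stable \<theta> \<psi> q w"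
proof -
  note smulE = \<open>normed_space_over smulE\<close> and split = \<open>direct_sum_splitting smulE Ep Em Pm\<close>
  obtain h :: "'a \<Rightarrow> real" where h: "bounded_linear h" "\<forall>v. h v = 0 \<longleftrightarrow> Pm v = 0"
    using line_coordinate[OF \<open>dim Em = 1\<close> splitting_projector(1,2)[OF smulE split]] .
  have kernel: "0 \<le> quadratic_form P v" if "h v = 0" for v
  proof (cases "v = 0")
    case True
    then show ?thesis by (simp add: quadratic_form_def pairing_def to_complex_0)
  next
    case False
    have "v \<in> Ep" using splitting_projector(3)[OF smulE split] that h(2) by blast
    then have "v \<in> Ep - {0}" using False by simp
    then show ?thesis
      by (intro less_imp_le bspec[OF \<open>\<forall>v\<in>Ep - {0}. quadratic_form P v > 0\<close>])
  qed
  have "squeezed_cocycle \<theta> \<psi> J (quadratic_form P) h \<sigma> \<nu>m \<nu>p \<nu>0 S"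
  proof (rule squeezed_cocycle.intro)
    show "inj (blinfun_apply J)"
      using \<open>continuous_embedding smulE smulH J\<close> by (simp add: continuous_embedding_def)
    show "\<exists>M. \<forall>v. quadratic_form P v \<le> M * (norm v)\<^sup>2"
      using quadratic_form_bound by blast
  qed (fact assms h(1) kernel continuous_quadratic_form)+
  from squeezed_cocycle.stable_periodic_trajectory[OF this] show ?thesis by blast
qed

end
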